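(* Let $Z$ be a Hilbert space with norm $\|\cdot\|_Z$ and inner product $\langle\cdot,\cdot\rangle_Z$. Consider the quasilinear equation $$\dot z(t)=Az(t)+f(z(t)),\qquad z(0)=z_0,$$ on $Z$, where $A:\mathcal D(A)\subset Z\to Z$ is a linear operator generating a $C_0$-semigroup on $Z$ and $f:\mathcal D(f)\subset Z\to Z$ is a nonlinear Fréchet differentiable operator, and suppose this equation generates a (nonlinear) semigroup $S(t)$ on $Z$. Let $z\in Z$ be an equilibrium point of the equation, let $r>0$, and set $N_{z,r}=\{p\in Z:\|p-z\|_Z\le r\}$. Assume that (a) $\mathrm{Re}\,\langle Ap,p\rangle_Z\le 0$ for all $p\in N_{z,r}\cap\mathcal D(A)$; (b) $f$ is Fréchet differentiable on $N_{z,r}$ and its Fréchet derivative $Df$ is locally Lipschitz continuous on $N_{z,r}$ (with respect to the operator norm); (c) $\sup_{\eta\in N_{z,r}}\|Df(\eta)\|_{op}=K_{z,r}<\infty$ for some positive constant $K_{z,r}$ depending on $z$ and $r$. Then the linearized equation $$\frac{d\psi}{dt}=A\psi+Df(z)\psi$$ generates a semigroup $T_z(t)$ on $Z$, and there exists $t_f>0$ such that for all $0\le t\le t_f$ $$T_z(t)=DS(z_0)(t),$$ where $DS(z_0)(t)$ is the Fréchet derivative of $S(t)$ at the initial condition $z(0)=z_0$ of the equilibrium solution, i.e. at $z_0=z$.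
   Context: $\|\cdot\|_{op}$ denotes the operator norm on bounded linear operators on $Z$. An equilibrium point is $z\in\mathcal D(A)\cap\mathcal D(f)$ with $Az+f(z)=0$. That the equation generates a semigroup $S(t)$ means that it is well-posed and its unique solution is $z(t)=S(t)z_0$, where $S(t)$ is a nonlinear $C_0$-semigroup on $Z$: $S(0)=I$, $S(t+s)=S(t)S(s)$ for $s,t\ge 0$, and $t\mapsto S(t)z_0$ is continuous for each $z_0$. An operator $G$ on $Z$ is Fréchet differentiable at $z_0$ if there is a bounded linear operator $DG(z_0)$ on $Z$ with $\lim_{h\to0}\|G(z_0+h)-G(z_0)-DG(z_0)h\|_Z/\|h\|_Z=0$; $DS(z_0)(t)$ denotes this derivative for $G=S(t)$. *)

theory Defs
  imports "HOL-Analysis.Analysis"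
begin

section \<open>Real or complex Hilbert spaces\<close>

text \<open>
  The scalar field is \<open>K = \<real>\<close> or \<open>K = UNIV\<close>, viewed as a set of complex numbers, so that
  one statement covers real and complex Hilbert spaces. \<open>sc\<close> is scalar multiplication
  (relevant only for scalars in \<open>K\<close>) and \<open>ip\<close> is the inner product, linear in its first argument.
  Completeness is supplied by the type class \<open>banach\<close>.
\<close>

locale hilbert_space =
  fixes K :: "complex set"
    and sc :: "complex \<Rightarrow> 'z::banach \<Rightarrow> 'z"
    and ip :: "'z \<Rightarrow> 'z \<Rightarrow> complex"
  assumes scalars: "K = \<real> \<or> K = UNIV"
    and sc_add_right: "c \<in> K \<Longrightarrow> sc c (x + y) = sc c x + sc c y"
    and sc_add_left: "c \<in> K \<Longrightarrow> d \<in> K \<Longrightarrow> sc (c + d) x = sc c x + sc d x"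
    and sc_mult: "c \<in> K \<Longrightarrow> d \<in> K \<Longrightarrow> sc (c * d) x = sc c (sc d x)"
    and sc_of_real: "sc (complex_of_real a) x = a *\<^sub>R x"
    and ip_in_K: "ip x y \<in> K"
    and ip_add_left: "ip (x + y) w = ip x w + ip y w"
    and ip_sc_left: "c \<in> K \<Longrightarrow> ip (sc c x) y = c * ip x y"
    and ip_commute: "ip y x = cnj (ip x y)"
    and norm_eq_sqrt_ip: "norm x = sqrt (Re (ip x x))"

section \<open>Linear operators and Frechet derivatives over K\<close>

definition linear_operator ::
    "complex set \<Rightarrow> (complex \<Rightarrow> 'z::real_normed_vector \<Rightarrow> 'z) \<Rightarrow> 'z set \<Rightarrow> ('z \<Rightarrow> 'z) \<Rightarrow> bool" where
  "linear_operator K sc D A \<longleftrightarrow>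
     0 \<in> D \<and>
     (\<forall>x\<in>D. \<forall>y\<in>D. x + y \<in> D \<and> A (x + y) = A x + A y) \<and>
     (\<forall>c\<in>K. \<forall>x\<in>D. sc c x \<in> D \<and> A (sc c x) = sc c (A x))"

definition bounded_operator ::
    "complex set \<Rightarrow> (complex \<Rightarrow> 'z::real_normed_vector \<Rightarrow> 'z) \<Rightarrow> ('z \<Rightarrow> 'z) \<Rightarrow> bool" where
  "bounded_operator K sc L \<longleftrightarrow> linear_operator K sc UNIV L \<and> bounded_linear L"

definition has_frechet_derivative ::
    "complex set \<Rightarrow> (complex \<Rightarrow> 'z::real_normed_vector \<Rightarrow> 'z) \<Rightarrow> 'z set \<Rightarrow>
     ('z \<Rightarrow> 'z) \<Rightarrow> ('z \<Rightarrow> 'z) \<Rightarrow> 'z \<Rightarrow> bool" where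
  "has_frechet_derivative K sc D G L p \<longleftrightarrow>
     p \<in> D \<and> bounded_operator K sc L \<and> (G has_derivative L) (at p within D)"

section \<open>Semigroups and generators\<close>

definition C0_semigroup :: "(real \<Rightarrow> 'z::real_normed_vector \<Rightarrow> 'z) \<Rightarrow> bool" where
  "C0_semigroup S \<longleftrightarrow>
     (\<forall>x. S 0 x = x) \<and>
     (\<forall>s\<ge>0. \<forall>t\<ge>0. \<forall>x. S (t + s) x = S t (S s x)) \<and>
     (\<forall>x. continuous_on {0..} (\<lambda>t. S t x))"

definition linear_C0_semigroup ::
    "complex set \<Rightarrow> (complex \<Rightarrow> 'z::real_normed_vector \<Rightarrow> 'z) \<Rightarrow> (real \<Rightarrow> 'z \<Rightarrow> 'z) \<Rightarrow> bool" where
  "linear_C0_semigroup K sc T \<longleftrightarrow> C0_semigroup T \<and> (\<forall>t\<ge>0. bounded_operator K sc (T t))"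

text \<open>The domain of a generator is part of the data: it consists of all \<open>x\<close> for which the
  difference quotient converges.\<close>

definition generates_C0_semigroup ::
    "complex set \<Rightarrow> (complex \<Rightarrow> 'z::real_normed_vector \<Rightarrow> 'z) \<Rightarrow> 'z set \<Rightarrow> ('z \<Rightarrow> 'z) \<Rightarrow>
     (real \<Rightarrow> 'z \<Rightarrow> 'z) \<Rightarrow> bool" where
  "generates_C0_semigroup K sc D A T \<longleftrightarrow>
     linear_C0_semigroup K sc T \<and>
     D = {x. \<exists>y. ((\<lambda>t. (T t x - x) /\<^sub>R t) \<longlongrightarrow> y) (at_right 0)} \<and>
     (\<forall>x\<in>D. ((\<lambda>t. (T t x - x) /\<^sub>R t) \<longlongrightarrow> A x) (at_right 0))"

section \<open>Mild solutions and well-posedness\<close>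

text \<open>
  The library predicate \<^const>\<open>has_bochner_integral\<close> requires a second countable target
  space, i.e. separability. The following is the same definition without that restriction.
\<close>

definition has_bochner_integral_ns ::
    "'a measure \<Rightarrow> ('a \<Rightarrow> 'b::real_normed_vector) \<Rightarrow> 'b \<Rightarrow> bool" where
  "has_bochner_integral_ns M g I \<longleftrightarrow>
     g \<in> borel_measurable M \<and>
     (\<exists>s. (\<forall>i::nat. Bochner_Integration.simple_bochner_integrable M (s i)) \<and>
          (\<lambda>i. \<integral>\<^sup>+ x. ennreal (norm (g x - s i x)) \<partial>M) \<longlonglongrightarrow> 0 \<and>
          (\<lambda>i. Bochner_Integration.simple_bochner_integral M (s i)) \<longlonglongrightarrow> I)"

text \<open>
  Mild solutions on \<open>[0, \<infinity>)\<close> of \<open>w' = A w + f w\<close>, \<open>w 0 = z0\<close>, where \<open>T\<close> is the semigroup generated by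
  \<open>A\<close> and \<open>dom_f\<close> is the domain of \<open>f\<close>, given by the variation of constants formula
  \<open>w t = T t z0 + \<integral>\<^bsub>0\<^esub>\<^bsup>t\<^esup> T (t - s) (f (w s)) ds\<close>. Membership in the domain of \<open>f\<close> is only required
  for almost every time, so that initial values outside of the domain of \<open>f\<close> are admitted.
\<close>

definition mild_solution ::
    "(real \<Rightarrow> 'z::real_normed_vector \<Rightarrow> 'z) \<Rightarrow> 'z set \<Rightarrow> ('z \<Rightarrow> 'z) \<Rightarrow> 'z \<Rightarrow> (real \<Rightarrow> 'z) \<Rightarrow> bool" where
  "mild_solution T dom_f f z0 w \<longleftrightarrow>
     continuous_on {0..} w \<and>
     (AE s in lebesgue_on {0..}. w s \<in> dom_f) \<and>
     (\<forall>t\<ge>0. (\<exists>I. has_bochner_integral_ns (lebesgue_on {0..t}) (\<lambda>s. f (w s)) I) \<and>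
            has_bochner_integral_ns (lebesgue_on {0..t}) (\<lambda>s. T (t - s) (f (w s)))
              (w t - T t z0))"

definition equation_generates ::
    "(real \<Rightarrow> 'z::real_normed_vector \<Rightarrow> 'z) \<Rightarrow> 'z set \<Rightarrow> ('z \<Rightarrow> 'z) \<Rightarrow> (real \<Rightarrow> 'z \<Rightarrow> 'z) \<Rightarrow> bool" where
  "equation_generates T dom_f f S \<longleftrightarrow>
     C0_semigroup S \<and>
     (\<forall>z0. mild_solution T dom_f f z0 (\<lambda>t. S t z0) \<and>
           (\<forall>w. mild_solution T dom_f f z0 w \<longrightarrow> (\<forall>t\<ge>0. w t = S t z0)))"

section \<open>Local Lipschitz continuity\<close>

definition locally_lipschitz_on :: "'a::metric_space set \<Rightarrow> ('a \<Rightarrow> 'b::metric_space) \<Rightarrow> bool" where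
  "locally_lipschitz_on N g \<longleftrightarrow> (\<forall>x\<in>N. \<exists>e>0. \<exists>C. C-lipschitz_on (ball x e \<inter> N) g)"

end

theory Submission
  imports Defs
begin

text \<open>
  Write \<open>B\<close> for the derivative of \<open>f\<close> at the equilibrium \<open>z\<close> and \<open>duhamel g t\<close> for
  \<open>\<integral>\<^bsub>0\<^esub>\<^bsup>t\<^esup> T (t - s) (g s) ds\<close>. The linearized equation is a bounded perturbation of the equation
  \<open>w' = A w\<close>, so its semigroup \<open>V\<close> is the sum of the Dyson series, the iteration of
  \<open>V t x = T t x + duhamel (\<lambda>s. B (V s x)) t\<close>. Gronwall's inequality (\<open>duhamel_gronwall\<close>) makes this
  fixed point unique, and uniqueness yields the linearity of \<open>V t\<close>, the semigroup law and the
  commutation with scalars. As \<open>duhamel g t / t\<close> tends to \<open>g 0\<close>, the difference quotients of \<open>V\<close>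
  and \<open>T\<close> converge at the same vectors, and the limits differ by \<open>B x\<close>: the generator is \<open>A + B\<close>
  on the domain of \<open>A\<close> (\<open>generates_perturbation\<close>).

  For the derivative of the flow, the identity \<open>T t z - z = duhamel (\<lambda>_. A z) t\<close> shows that the
  constant \<open>z\<close> is a mild solution, so \<open>S t z = z\<close>. Close to \<open>z\<close> the differentiability of \<open>f\<close> at \<open>z\<close>
  bounds \<open>norm (f y - f z)\<close> by a multiple of \<open>norm (y - z)\<close>. Gronwall's inequality then gives
  \<open>norm (S t p - z) \<le> C * norm (p - z)\<close> for as long as the solution stays close to \<open>z\<close>, and for \<open>p\<close>
  close to \<open>z\<close> this estimate itself forbids it to leave before a given time (\<open>continuous_trapped\<close>).
  Finally \<open>S t p - z - V t (p - z)\<close> solves the linearized equation with initial value \<open>0\<close> and the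
  source \<open>f (S t p) - f z - B (S t p - z)\<close>, which is \<open>o(norm (p - z))\<close> uniformly on bounded time
  intervals; a last use of Gronwall's inequality shows that \<open>V t\<close> is the derivative of \<open>S t\<close> at \<open>z\<close>
  (\<open>flow_has_derivative\<close>). The argument works for every time \<open>t\<close>, so \<open>t_f = 1\<close> will do.

  Integrals of vector-valued functions are computed as gauge integrals. They agree with the Bochner
  integrals in the definition of a mild solution because every integrand that occurs is continuous
  (\<open>has_bochner_integral_ns_continuous_eq\<close>).
\<close>

section \<open>Bochner integrals of continuous functions\<close>

text \<open>In a space that is not second countable, the difference of two Borel functions may fail to be
  Borel. It does not fail if one of them takes only finitely many values.\<close>

lemma borel_measurable_norm_diff_simple:
  fixes g :: "'a \<Rightarrow> 'b::real_normed_vector"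
  assumes g: "g \<in> borel_measurable M" and s: "simple_function M s"
  shows "(\<lambda>x. norm (g x - s x)) \<in> borel_measurable M"
proof (rule measurable_compose_countable'[where f="\<lambda>y x. norm (g x - y)" and g=s and I="s ` space M"])
  show "(\<lambda>x. norm (g x - y)) \<in> borel_measurable M" for y
    by (rule borel_measurable_continuous_on[OF _ g]) (intro continuous_intros)
  show "s \<in> measurable M (count_space (s ` space M))"
    using s by (auto simp: simple_function_def measurable_count_space_eq2)
  show "countable (s ` space M)"
    using s by (auto simp: simple_function_def countable_finite)
qed

lemma simple_bochner_integral_dist_le:
  fixes s u :: "'a \<Rightarrow> 'b::real_normed_vector"
  assumes g: "g \<in> borel_measurable M"
    and s: "Bochner_Integration.simple_bochner_integrable M s"
    and u: "Bochner_Integration.simple_bochner_integrable M u"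
  shows "ennreal (norm (Bochner_Integration.simple_bochner_integral M s
            - Bochner_Integration.simple_bochner_integral M u))
         \<le> (\<integral>\<^sup>+ x. ennreal (norm (g x - s x)) \<partial>M) + (\<integral>\<^sup>+ x. ennreal (norm (g x - u x)) \<partial>M)"
proof -
  have sf: "simple_function M s" "simple_function M u"
    using s u by (auto elim: simple_bochner_integrable.cases)
  note [measurable] = borel_measurable_norm_diff_simple[OF g sf(1)]
    borel_measurable_norm_diff_simple[OF g sf(2)]
  have d: "Bochner_Integration.simple_bochner_integrable M (\<lambda>x. s x - u x)"
    by (rule simple_bochner_integrable_compose2[OF _ s u]) simp
  have nd: "Bochner_Integration.simple_bochner_integrable M (\<lambda>x. norm (s x - u x))"
    by (rule simple_bochner_integrable_compose2[OF _ s u]) simp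
  have "ennreal (norm (Bochner_Integration.simple_bochner_integral M s
            - Bochner_Integration.simple_bochner_integral M u))
      \<le> ennreal (Bochner_Integration.simple_bochner_integral M (\<lambda>x. norm (s x - u x)))"
    using simple_bochner_integral_norm_bound[OF d]
    by (simp add: simple_bochner_integral_diff[OF s u])
  also have "\<dots> = (\<integral>\<^sup>+ x. ennreal (norm (s x - u x)) \<partial>M)"
    by (rule simple_bochner_integral_eq_nn_integral[OF nd]) simp
  also have "\<dots> \<le> (\<integral>\<^sup>+ x. ennreal (norm (g x - s x)) + ennreal (norm (g x - u x)) \<partial>M)"
  proof (intro nn_integral_mono)
    fix x
    have "norm (s x - u x) \<le> norm (g x - s x) + norm (g x - u x)"
      using norm_triangle_ineq4[of "g x - u x" "g x - s x"] by simp
    then show "ennreal (norm (s x - u x)) \<le> ennreal (norm (g x - s x)) + ennreal (norm (g x - u x))"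
      by (simp flip: ennreal_plus)
  qed
  also have "\<dots> = (\<integral>\<^sup>+ x. ennreal (norm (g x - s x)) \<partial>M) + (\<integral>\<^sup>+ x. ennreal (norm (g x - u x)) \<partial>M)"
    by (rule nn_integral_add) auto
  finally show ?thesis .
qed

text \<open>Two approximating sequences of simple functions become close in mean, since both converge to the
  same function; hence their integrals have the same limit.\<close>

lemma has_bochner_integral_ns_unique:
  assumes I: "has_bochner_integral_ns M g I" and J: "has_bochner_integral_ns M g J"
  shows "I = J"
proof -
  obtain s where g: "g \<in> borel_measurable M"
    and s: "\<And>i::nat. Bochner_Integration.simple_bochner_integrable M (s i)"
      "(\<lambda>i. \<integral>\<^sup>+ x. ennreal (norm (g x - s i x)) \<partial>M) \<longlonglongrightarrow> 0"
      "(\<lambda>i. Bochner_Integration.simple_bochner_integral M (s i)) \<longlonglongrightarrow> I"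
    using I unfolding has_bochner_integral_ns_def by blast
  obtain u where u: "\<And>i::nat. Bochner_Integration.simple_bochner_integrable M (u i)"
      "(\<lambda>i. \<integral>\<^sup>+ x. ennreal (norm (g x - u i x)) \<partial>M) \<longlonglongrightarrow> 0"
      "(\<lambda>i. Bochner_Integration.simple_bochner_integral M (u i)) \<longlonglongrightarrow> J"
    using J unfolding has_bochner_integral_ns_def by blast
  let ?d = "\<lambda>i. norm (Bochner_Integration.simple_bochner_integral M (s i)
            - Bochner_Integration.simple_bochner_integral M (u i))"
  have "(\<lambda>i. ennreal (?d i)) \<longlonglongrightarrow> 0"
  proof (rule tendsto_sandwich[OF _ _ tendsto_const])
    show "(\<lambda>i. (\<integral>\<^sup>+ x. ennreal (norm (g x - s i x)) \<partial>M) + (\<integral>\<^sup>+ x. ennreal (norm (g x - u i x)) \<partial>M))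
        \<longlonglongrightarrow> 0"
      using tendsto_add[OF s(2) u(2)] by simp
    show "\<forall>\<^sub>F i in sequentially. ennreal (?d i) \<le>
       (\<integral>\<^sup>+ x. ennreal (norm (g x - s i x)) \<partial>M) + (\<integral>\<^sup>+ x. ennreal (norm (g x - u i x)) \<partial>M)"
      using simple_bochner_integral_dist_le[OF g s(1) u(1)] by simp
  qed simp
  then have "?d \<longlonglongrightarrow> 0"
    by (simp add: tendsto_ennreal_iff flip: ennreal_0)
  moreover have "?d \<longlonglongrightarrow> norm (I - J)"
    by (intro tendsto_intros s u)
  ultimately show ?thesis
    using LIMSEQ_unique by force
qed

lemma simple_bochner_integral_has_integral:
  fixes s :: "'a::euclidean_space \<Rightarrow> 'b::real_normed_vector"
  assumes S: "S \<in> lmeasurable" and s: "simple_function (lebesgue_on S) s"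
  shows "(s has_integral Bochner_Integration.simple_bochner_integral (lebesgue_on S) s) S"
proof -
  let ?P = "\<lambda>y. {x\<in>S. s x = y}"
  have fin: "finite (s ` S)" and Pm: "\<And>y. y \<in> s ` S \<Longrightarrow> ?P y \<in> sets (lebesgue_on S)"
    using s by (auto simp: simple_function_def vimage_def Int_def conj_commute)
  have Slm: "S \<in> sets lebesgue" using S by (rule fmeasurableD)
  have Pl: "?P y \<in> lmeasurable" if "y \<in> s ` S" for y
  proof (rule fmeasurableI2[OF S])
    show "?P y \<in> sets lebesgue"
      using Pm[OF that] Slm by (simp add: sets_restrict_space_iff)
  qed auto
  have one: "((\<lambda>x. indicat_real (?P y) x *\<^sub>R y) has_integral measure (lebesgue_on S) (?P y) *\<^sub>R y) S"
    if y: "y \<in> s ` S" for y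
  proof -
    have "(indicat_real (?P y) has_integral measure lebesgue (?P y)) UNIV"
      using Pl[OF y] lmeasurable_iff_has_integral by blast
    then have "((\<lambda>x. if x \<in> S then indicat_real (?P y) x else 0) has_integral
        measure lebesgue (?P y)) UNIV"
      by (rule has_integral_eq[rotated]) auto
    then have "(indicat_real (?P y) has_integral measure lebesgue (?P y)) S"
      by (simp only: has_integral_restrict_UNIV)
    from has_integral_scaleR_left[OF this, of y]
    show ?thesis
      using Slm by (subst measure_restrict_space) auto
  qed
  have "((\<lambda>x. \<Sum>y\<in>s ` S. indicat_real (?P y) x *\<^sub>R y) has_integral
      (\<Sum>y\<in>s ` S. measure (lebesgue_on S) (?P y) *\<^sub>R y)) S"
    using has_integral_sum[OF fin one] by simp
  moreover have "(\<Sum>y\<in>s ` S. indicat_real (?P y) x *\<^sub>R y) = s x" if "x \<in> S" for x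
  proof -
    have "(\<Sum>y\<in>s ` S. indicat_real (?P y) x *\<^sub>R y) = (\<Sum>y\<in>s ` S. if y = s x then y else 0)"
      using that by (intro sum.cong) auto
    also have "\<dots> = s x" using fin that by simp
    finally show ?thesis .
  qed
  ultimately have "(s has_integral (\<Sum>y\<in>s ` S. measure (lebesgue_on S) (?P y) *\<^sub>R y)) S"
    by (rule has_integral_eq[rotated])
  then show ?thesis
    by (simp add: simple_bochner_integral_def space_restrict_space)
qed

text \<open>By uniform continuity, the step functions that sample \<open>g\<close> on the grid \<open>\<int> / (n + 1)\<close>
  converge uniformly to \<open>g\<close>. Uniform convergence on a bounded interval gives both convergence in mean
  and convergence of the gauge integrals.\<close>

lemma continuous_has_bochner_integral_ns:
  fixes g :: "real \<Rightarrow> 'b::banach"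
  assumes t: "0 \<le> t" and g: "continuous_on {0..t} g"
  shows "has_bochner_integral_ns (lebesgue_on {0..t}) g (integral {0..t} g)"
proof -
  let ?M = "lebesgue_on {0..t}"
  \<comment> \<open>The largest multiple of \<open>1 / (n + 1)\<close> not exceeding \<open>x\<close>; it stays in \<open>{0..t}\<close> with \<open>x\<close>, where \<open>g\<close> is continuous.\<close>
  define p where "p n x = of_int \<lfloor>real (Suc n) * x\<rfloor> / real (Suc n)" for n x
  have p1: "p n x \<le> x" "x - p n x \<le> inverse (real (Suc n))" for n x
  proof -
    have "of_int \<lfloor>real (Suc n) * x\<rfloor> \<le> real (Suc n) * x" by linarith
    then show "p n x \<le> x" by (simp add: p_def field_simps)
    have "(real (Suc n) * x - of_int \<lfloor>real (Suc n) * x\<rfloor>) / real (Suc n) \<le> 1 / real (Suc n)"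
      by (intro divide_right_mono) linarith+
    then show "x - p n x \<le> inverse (real (Suc n))"
      by (simp add: p_def diff_divide_distrib inverse_eq_divide del: of_nat_Suc)
  qed
  have p0: "0 \<le> p n x" if "0 \<le> x" for n x
    using that by (simp add: p_def)
  define s where "s n x = g (p n x)" for n x
  have sf: "simple_function ?M (s n)" for n
  proof -
    have fl: "simple_function ?M (\<lambda>x. \<lfloor>real (Suc n) * x\<rfloor>)"
      unfolding simple_function_def
    proof (intro conjI ballI)
      have "(\<lambda>x. \<lfloor>real (Suc n) * x\<rfloor>) ` {0..t} \<subseteq> {0..\<lfloor>real (Suc n) * t\<rfloor>}"
        by (auto intro!: floor_mono mult_left_mono)
      then show "finite ((\<lambda>x. \<lfloor>real (Suc n) * x\<rfloor>) ` space ?M)"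
        by (simp add: space_restrict_space finite_subset)
      fix k :: int
      have "(\<lambda>x. \<lfloor>real (Suc n) * x\<rfloor>) \<in> measurable borel (count_space UNIV)"
        by measurable
      then have "(\<lambda>x. \<lfloor>real (Suc n) * x\<rfloor>) -` {k} \<inter> space borel \<in> sets (borel::real measure)"
        by (rule measurable_sets) simp
      then show "(\<lambda>x. \<lfloor>real (Suc n) * x\<rfloor>) -` {k} \<inter> space ?M \<in> sets ?M"
        by (simp add: sets_restrict_space space_restrict_space Int_commute[of _ "{0..t}"])
    qed
    have "simple_function ?M ((\<lambda>k. g (of_int k / real (Suc n))) \<circ> (\<lambda>x. \<lfloor>real (Suc n) * x\<rfloor>))"
      by (rule simple_function_compose[OF fl])
    then show ?thesis by (simp add: s_def[abs_def] p_def comp_def)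
  qed
  have em: "emeasure ?M (space ?M) = ennreal t"
    using t by (simp add: space_restrict_space emeasure_restrict_space)
  have sb: "Bochner_Integration.simple_bochner_integrable ?M (s n)" for n
  proof
    have "emeasure ?M {y \<in> space ?M. s n y \<noteq> 0} \<le> ennreal t"
      using emeasure_space[of ?M] by (simp only: em)
    then show "emeasure ?M {y \<in> space ?M. s n y \<noteq> 0} \<noteq> \<infinity>"
      by (auto simp: top_unique)
  qed (rule sf)
  have gm: "g \<in> borel_measurable ?M"
  proof -
    have m: "g \<in> borel_measurable (restrict_space borel {0..t})"
      by (rule borel_measurable_continuous_on_restrict[OF g])
    show ?thesis
    proof (rule measurableI)
      fix V :: "'b set" assume "V \<in> sets borel"
      then have "g -` V \<inter> space (restrict_space borel {0..t}) \<in> sets (restrict_space borel {0..t})"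
        by (rule measurable_sets[OF m])
      then obtain W where "W \<in> sets borel" and W: "g -` V \<inter> {0..t} = {0..t} \<inter> W"
        by (auto simp: sets_restrict_space space_restrict_space)
      then have "{0..t} \<inter> W \<in> sets ?M"
        by (simp add: sets_restrict_space)
      then show "g -` V \<inter> space ?M \<in> sets ?M"
        by (simp add: space_restrict_space W)
    qed simp
  qed
  have unif: "\<exists>N. \<forall>n\<ge>N. \<forall>x\<in>{0..t}. norm (g x - s n x) \<le> e" if e: "e > 0" for e
  proof -
    have "uniformly_continuous_on {0..t} g"
      by (rule compact_uniformly_continuous[OF g]) simp
    then obtain d where d: "d > 0"
      "\<And>x y. x \<in> {0..t} \<Longrightarrow> y \<in> {0..t} \<Longrightarrow> dist y x < d \<Longrightarrow> dist (g y) (g x) < e"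
      using e by (rule uniformly_continuous_onE) blast
    obtain N where N: "inverse (real (Suc N)) < d"
      using reals_Archimedean[OF d(1)] by auto
    have "norm (g x - s n x) \<le> e" if n: "n \<ge> N" and x: "x \<in> {0..t}" for n x
    proof -
      have "inverse (real (Suc n)) \<le> inverse (real (Suc N))"
        using n by (intro le_imp_inverse_le) auto
      then have "dist x (p n x) < d"
        using p1(1)[of n x] p1(2)[of x n] N unfolding dist_real_def by linarith
      moreover have "p n x \<in> {0..t}" using p0[of x n] p1(1)[of n x] x by auto
      ultimately show ?thesis
        using d(2)[of "p n x" x] x by (simp add: s_def dist_norm)
    qed
    then show ?thesis by blast
  qed
  have si: "(s n has_integral Bochner_Integration.simple_bochner_integral ?M (s n)) {0..t}" for n
    by (rule simple_bochner_integral_has_integral[OF _ sf]) simp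
  have gi: "g integrable_on {0..t}"
    by (rule integrable_continuous_real[OF g])
  have "(\<lambda>n. \<integral>\<^sup>+ x. ennreal (norm (g x - s n x)) \<partial>?M) \<longlonglongrightarrow> 0"
  proof (rule tendsto_zero_ennreal)
    fix r :: real assume r: "0 < r"
    define e where "e = r / (2 * (t + 1))"
    have e: "e > 0" using r t by (simp add: e_def)
    obtain N where N: "\<And>n x. n \<ge> N \<Longrightarrow> x \<in> {0..t} \<Longrightarrow> norm (g x - s n x) \<le> e"
      using unif[OF e] by blast
    have "(\<integral>\<^sup>+ x. ennreal (norm (g x - s n x)) \<partial>?M) < ennreal r" if n: "n \<ge> N" for n
    proof -
      have "(\<integral>\<^sup>+ x. ennreal (norm (g x - s n x)) \<partial>?M) \<le> (\<integral>\<^sup>+ x. ennreal e \<partial>?M)"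
        by (intro nn_integral_mono ennreal_leI N[OF n]) (simp add: space_restrict_space)
      also have "\<dots> = ennreal (e * t)"
        by (simp only: nn_integral_const em ennreal_mult[OF less_imp_le[OF e] t])
      also have "\<dots> < ennreal r"
      proof -
        have "r * t < r * (2 * (t + 1))" using r t by (intro mult_strict_left_mono) auto
        then have "e * t < r" using t by (simp add: e_def divide_less_eq)
        then show ?thesis using r by (simp add: ennreal_lessI)
      qed
      finally show ?thesis .
    qed
    then show "\<forall>\<^sub>F n in sequentially. (\<integral>\<^sup>+ x. ennreal (norm (g x - s n x)) \<partial>?M) < ennreal r"
      by (rule eventually_sequentiallyI)
  qed
  moreover have "(\<lambda>n. Bochner_Integration.simple_bochner_integral ?M (s n)) \<longlonglongrightarrow> integral {0..t} g"
  proof (rule LIMSEQ_I)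
    fix r :: real assume r: "0 < r"
    define e where "e = r / (2 * (t + 1))"
    have e: "e > 0" using r t by (simp add: e_def)
    obtain N where N: "\<And>n x. n \<ge> N \<Longrightarrow> x \<in> {0..t} \<Longrightarrow> norm (g x - s n x) \<le> e"
      using unif[OF e] by blast
    have "norm (Bochner_Integration.simple_bochner_integral ?M (s n) - integral {0..t} g) < r"
      if n: "n \<ge> N" for n
    proof -
      have "((\<lambda>x. g x - s n x) has_integral
          integral {0..t} g - Bochner_Integration.simple_bochner_integral ?M (s n)) {0..t}"
        by (intro has_integral_diff si integrable_integral gi)
      then have "norm (integral {0..t} g - Bochner_Integration.simple_bochner_integral ?M (s n))
          \<le> e * t"
        using has_integral_bound_real[of e "{}" "\<lambda>x. g x - s n x" _ 0 t] N[OF n] e t by simp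
      also have "\<dots> < r"
      proof -
        have "r * t < r * (2 * (t + 1))" using r t by (intro mult_strict_left_mono) auto
        then show ?thesis using t by (simp add: e_def divide_less_eq)
      qed
      finally show ?thesis by (simp add: norm_minus_commute)
    qed
    then show "\<exists>no. \<forall>n\<ge>no. norm (Bochner_Integration.simple_bochner_integral ?M (s n)
        - integral {0..t} g) < r"
      by (intro exI[of _ N] allI impI)
  qed
  ultimately show ?thesis
    unfolding has_bochner_integral_ns_def by (intro conjI exI[of _ s] allI gm sb)
qed

lemma has_bochner_integral_ns_continuous_eq:
  fixes g :: "real \<Rightarrow> 'b::banach"
  assumes "0 \<le> t" and "continuous_on {0..t} g"
  shows "has_bochner_integral_ns (lebesgue_on {0..t}) g I \<longleftrightarrow> I = integral {0..t} g"
  using continuous_has_bochner_integral_ns[OF assms] has_bochner_integral_ns_unique by blast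

section \<open>Gronwall's inequality\<close>

text \<open>The quantity \<open>exp (- L * s) * (C + L * integral {0..s} u)\<close> is nonincreasing in \<open>s\<close> and equals
  \<open>C\<close> at \<open>s = 0\<close>.\<close>

lemma gronwall_integral:
  fixes u :: "real \<Rightarrow> real"
  assumes L: "0 \<le> L" and u: "continuous_on {0..a} u"
    and le: "\<And>t. t \<in> {0..a} \<Longrightarrow> u t \<le> C + L * integral {0..t} u"
    and t: "t \<in> {0..a}"
  shows "u t \<le> C * exp (L * t)"
proof (cases "t = 0")
  case True
  then show ?thesis using le[of 0] t by simp
next
  case False
  then have t0: "0 < t" "t \<le> a" using t by auto
  have ut: "continuous_on {0..t} u"
    by (rule continuous_on_subset[OF u]) (use t0 in auto)
  let ?F = "\<lambda>s. exp (- L * s) * (C + L * integral {0..s} u)"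
  have "?F t \<le> ?F 0"
  proof (rule DERIV_nonpos_imp_decreasing_open[OF less_imp_le[OF t0(1)]])
    show "continuous_on {0..t} ?F"
      by (intro continuous_intros indefinite_integral_continuous_1 integrable_continuous_real ut)
    fix x assume x: "0 < x" "x < t"
    have "((\<lambda>s. integral {0..s} u) has_vector_derivative u x) (at x within {0..t})"
      by (rule integral_has_vector_derivative[OF ut]) (use x in auto)
    then have D: "((\<lambda>s. integral {0..s} u) has_real_derivative u x) (at x)"
      using x by (simp add: has_real_derivative_iff_has_vector_derivative at_within_Icc_at)
    have "(?F has_real_derivative
        exp (- L * x) * (L * (u x - (C + L * integral {0..x} u)))) (at x)"
      by (rule derivative_eq_intros D refl)+ (simp add: algebra_simps)
    moreover have "exp (- L * x) * (L * (u x - (C + L * integral {0..x} u))) \<le> 0"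
      using le[of x] x t0 L by (intro mult_nonneg_nonpos) auto
    ultimately show "\<exists>y. (?F has_real_derivative y) (at x) \<and> y \<le> 0" by blast
  qed
  then have "exp (- L * t) * (C + L * integral {0..t} u) \<le> C" by simp
  then have "exp (L * t) * (exp (- L * t) * (C + L * integral {0..t} u)) \<le> exp (L * t) * C"
    by (intro mult_left_mono) auto
  then have "C + L * integral {0..t} u \<le> C * exp (L * t)"
    by (simp add: mult.commute flip: exp_add mult.assoc)
  then show ?thesis using le[OF t] by linarith
qed

section \<open>Uniform boundedness and joint continuity of a linear semigroup\<close>

text \<open>The Banach-Steinhaus theorem. By Baire's theorem one of the closed sets on which the family is
  bounded by a fixed number contains a ball, and linearity carries the bound from this ball to the
  unit ball.\<close>

lemma uniform_boundedness:
  fixes F :: "'i \<Rightarrow> 'a::banach \<Rightarrow> 'b::real_normed_vector"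
  assumes lin: "\<And>i. i \<in> I \<Longrightarrow> bounded_linear (F i)"
    and bdd: "\<And>x. \<exists>c. \<forall>i\<in>I. norm (F i x) \<le> c"
  obtains M where "\<And>i x. i \<in> I \<Longrightarrow> norm (F i x) \<le> M * norm x"
proof -
  define E where "E n = {x. \<forall>i\<in>I. norm (F i x) \<le> real n}" for n :: nat
  have Ecl: "closed (E n)" for n
  proof -
    have "E n = (\<Inter>i\<in>I. {x. norm (F i x) \<le> real n})" by (auto simp: E_def)
    moreover have "closed {x. norm (F i x) \<le> real n}" if "i \<in> I" for i
      by (intro closed_Collect_le continuous_intros
          linear_continuous_on[OF lin[OF that]])
    ultimately show ?thesis by auto
  qed
  have "\<Union> (range E) = UNIV"
  proof (intro set_eqI iffI UNIV_I)
    fix x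
    obtain c where c: "\<forall>i\<in>I. norm (F i x) \<le> c" using bdd by blast
    obtain n :: nat where "c \<le> real n" using real_arch_simple by blast
    with c have "x \<in> E n" by (force simp: E_def)
    then show "x \<in> \<Union> (range E)" by blast
  qed
  have "\<exists>n. interior (E n) \<noteq> {}"
  proof (rule ccontr)
    assume "\<nexists>n. interior (E n) \<noteq> {}"
    then have "Met_TC.mtopology interior_of \<Union> (range E) = {}"
      by (intro Met_TC.metric_Baire_category_alt)
        (auto simp: Ecl mcomplete_iff_complete complete_UNIV)
    then show False using \<open>\<Union> (range E) = UNIV\<close> by simp
  qed
  then obtain n x0 where "x0 \<in> interior (E n)" by blast
  then obtain e where e: "e > 0" "cball x0 e \<subseteq> E n"
    by (meson mem_interior_cball)
  have "norm (F i x) \<le> (2 * real n / e) * norm x" if i: "i \<in> I" for i x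
  proof (cases "x = 0")
    case True
    then show ?thesis using linear_simps(3)[OF lin[OF i]] by simp
  next
    case False
    interpret bounded_linear "F i" by (rule lin[OF i])
    let ?y = "(e / norm x) *\<^sub>R x"
    have "x0 + ?y \<in> cball x0 e" using False e by (simp add: dist_norm)
    moreover have "x0 \<in> cball x0 e" using e by simp
    ultimately have "x0 + ?y \<in> E n" "x0 \<in> E n" using e(2) by blast+
    then have "norm (F i (x0 + ?y)) \<le> n" "norm (F i x0) \<le> n"
      using i by (auto simp: E_def)
    then have "norm (F i ?y) \<le> 2 * n"
      using norm_triangle_ineq4[of "F i (x0 + ?y)" "F i x0"] by (simp add: add)
    then have "e / norm x * norm (F i x) \<le> 2 * n"
      using e by (simp add: scaleR)
    then show ?thesis using False e by (simp add: field_simps)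
  qed
  then show thesis by (rule that)
qed

locale linear_semigroup =
  fixes T :: "real \<Rightarrow> 'z::banach \<Rightarrow> 'z"
  assumes c0: "C0_semigroup T"
    and lin: "0 \<le> t \<Longrightarrow> bounded_linear (T t)"
begin

lemma T_zero: "T 0 x = x"
  using c0 by (simp add: C0_semigroup_def)

lemma T_plus: "0 \<le> s \<Longrightarrow> 0 \<le> t \<Longrightarrow> T (t + s) x = T t (T s x)"
  using c0 by (simp add: C0_semigroup_def)

lemma T_continuous: "continuous_on {0..} (\<lambda>t. T t x)"
  using c0 by (simp add: C0_semigroup_def)

text \<open>Orbits are bounded on a compact time interval because they are continuous; uniform boundedness
  turns this into a bound for the operators.\<close>

lemma T_bound:
  obtains M where "1 \<le> M" "\<And>t x. t \<in> {0..a} \<Longrightarrow> norm (T t x) \<le> M * norm x"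
proof -
  have "\<exists>c. \<forall>t\<in>{0..a}. norm (T t x) \<le> c" for x
  proof -
    have "continuous_on {0..a} (\<lambda>t. T t x)"
      by (rule continuous_on_subset[OF T_continuous]) auto
    then have "bounded ((\<lambda>t. T t x) ` {0..a})"
      by (intro compact_imp_bounded compact_continuous_image) auto
    then show ?thesis by (auto simp: bounded_iff)
  qed
  then obtain M where M: "\<And>t x. t \<in> {0..a} \<Longrightarrow> norm (T t x) \<le> M * norm x"
    using uniform_boundedness[of "{0..a}" T] lin by (metis atLeastAtMost_iff)
  show thesis
  proof (rule that[of "max M 1"])
    show "norm (T t x) \<le> max M 1 * norm x" if "t \<in> {0..a}" for t x
      by (rule order_trans[OF M[OF that]]) (intro mult_right_mono, auto)
  qed auto
qed

text \<open>Continuity in time for each vector and a bound for the operators that is locally uniform in time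
  give joint continuity, which makes all integrands below continuous.\<close>

lemma T_jointly_continuous: "continuous_on ({0..} \<times> UNIV) (\<lambda>(t, x). T t x)"
  unfolding continuous_on_def
proof clarsimp
  fix t0 :: real and x0 :: 'z assume t0: "0 \<le> t0"
  let ?F = "at (t0, x0) within {0..} \<times> UNIV"
  obtain M where M: "1 \<le> M" "\<And>t x. t \<in> {0..t0 + 1} \<Longrightarrow> norm (T t x) \<le> M * norm x"
    using T_bound by blast
  have fs: "(fst \<longlongrightarrow> t0) ?F" "(snd \<longlongrightarrow> x0) ?F"
    using tendsto_fst[OF tendsto_ident_at] tendsto_snd[OF tendsto_ident_at] by force+
  have inX: "\<forall>\<^sub>F p in ?F. fst p \<in> {0..}"
    by (auto simp: eventually_at_topological intro!: exI[of _ UNIV])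
  have "((\<lambda>p. M * norm (snd p - x0) + norm (T (fst p) x0 - T t0 x0)) \<longlongrightarrow>
      M * norm (x0 - x0) + norm (T t0 x0 - T t0 x0)) ?F"
    by (intro tendsto_intros fs continuous_on_tendsto_compose[OF T_continuous _ _ inX]) (use t0 in auto)
  then have lim: "((\<lambda>p. M * norm (snd p - x0) + norm (T (fst p) x0 - T t0 x0)) \<longlongrightarrow> 0) ?F"
    by simp
  have "\<forall>\<^sub>F p in ?F. fst p < t0 + 1"
    by (rule order_tendstoD[OF fs(1)]) simp
  with inX have "\<forall>\<^sub>F p in ?F. norm (T (fst p) (snd p) - T t0 x0)
      \<le> M * norm (snd p - x0) + norm (T (fst p) x0 - T t0 x0)"
  proof eventually_elim
    case (elim p)
    interpret bounded_linear "T (fst p)" by (rule lin) (use elim in auto)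
    have "norm (T (fst p) (snd p - x0)) \<le> M * norm (snd p - x0)"
      by (rule M) (use elim in auto)
    then show ?case
      using norm_triangle_ineq[of "T (fst p) (snd p) - T (fst p) x0" "T (fst p) x0 - T t0 x0"]
      by (simp add: diff)
  qed
  then have "((\<lambda>p. T (fst p) (snd p) - T t0 x0) \<longlongrightarrow> 0) ?F"
    by (rule Lim_null_comparison[OF _ lim])
  then show "((\<lambda>(t, x). T t x) \<longlongrightarrow> T t0 x0) ?F"
    by (simp add: LIM_zero_iff case_prod_beta')
qed

lemma continuous_on_T [continuous_intros]:
  assumes "continuous_on X p" "continuous_on X g" "\<And>y. y \<in> X \<Longrightarrow> 0 \<le> p y"
  shows "continuous_on X (\<lambda>y. T (p y) (g y))"
  using continuous_on_compose2[OF T_jointly_continuous, of X "\<lambda>y. (p y, g y)"] assms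
  by (auto intro!: continuous_intros)

section \<open>Duhamel integrals\<close>

definition duhamel :: "(real \<Rightarrow> 'z) \<Rightarrow> real \<Rightarrow> 'z" where
  "duhamel g t = integral {0..t} (\<lambda>s. T (t - s) (g s))"

text \<open>
  The Duhamel integral divided by \<open>t\<close>, rescaled to the unit interval. As the end points are fixed,
  continuity in \<open>t\<close> follows from the continuity of parameter integrals, also at \<open>t = 0\<close>, where the
  quotient itself is undefined.
\<close>

definition duhamel_mean :: "(real \<Rightarrow> 'z) \<Rightarrow> real \<Rightarrow> 'z" where
  "duhamel_mean g t = integral {0..1} (\<lambda>u. T (t * (1 - u)) (g (t * u)))"

lemma duhamel_continuous_integrand:
  "continuous_on {0..t} g \<Longrightarrow> continuous_on {0..t} (\<lambda>s. T (t - s) (g s))"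
  by (auto intro!: continuous_intros)

lemma duhamel_integrable:
  "continuous_on {0..t} g \<Longrightarrow> (\<lambda>s. T (t - s) (g s)) integrable_on {0..t}"
  by (rule integrable_continuous_real[OF duhamel_continuous_integrand])

lemma duhamel_eq_mean:
  assumes t: "0 \<le> t" and g: "continuous_on {0..t} g"
  shows "duhamel g t = t *\<^sub>R duhamel_mean g t"
proof (cases "t = 0")
  case False
  with t have t0: "0 < t" by simp
  have "((\<lambda>s. T (t - s) (g s)) has_integral duhamel g t) (cbox 0 t)"
    using integrable_integral[OF duhamel_integrable[OF g]] by (simp add: duhamel_def)
  from has_integral_affinity'[OF this t0, of 0]
  have "((\<lambda>u. T (t - t * u) (g (t * u))) has_integral duhamel g t /\<^sub>R t) {0..1}"
    using t0 by simp
  then have "duhamel_mean g t = duhamel g t /\<^sub>R t"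
    unfolding duhamel_mean_def by (simp add: integral_unique right_diff_distrib)
  then show ?thesis using t0 by simp
qed (simp add: duhamel_def)

lemma continuous_on_duhamel_mean:
  assumes g: "continuous_on {0..} g"
  shows "continuous_on {0..} (duhamel_mean g)"
proof -
  have "continuous_on {0..} (\<lambda>t. integral (cbox 0 1) ((\<lambda>t u. T (t * (1 - u)) (g (t * u))) t))"
  proof (rule integral_continuous_on_param)
    have "continuous_on ({0..} \<times> cbox 0 1) (\<lambda>p. T (fst p * (1 - snd p)) (g (fst p * snd p)))"
      by (intro continuous_intros continuous_on_compose2[OF g]) auto
    then show "continuous_on ({0..} \<times> cbox 0 1) (\<lambda>(t, u). T (t * (1 - u)) (g (t * u)))"
      by (simp add: case_prod_beta')
  qed
  then show ?thesis by (simp add: duhamel_mean_def[abs_def])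
qed

lemma continuous_on_duhamel:
  assumes g: "continuous_on {0..} g"
  shows "continuous_on {0..} (duhamel g)"
proof -
  have "continuous_on {0..} (\<lambda>t. t *\<^sub>R duhamel_mean g t)"
    by (intro continuous_intros continuous_on_duhamel_mean g)
  moreover have "t *\<^sub>R duhamel_mean g t = duhamel g t" if "t \<in> {0..}" for t
    using duhamel_eq_mean[of t g] that continuous_on_subset[OF g, of "{0..t}"] by auto
  ultimately show ?thesis by (rule continuous_on_eq)
qed

lemma duhamel_mean_tendsto:
  assumes g: "continuous_on {0..} g"
  shows "(duhamel_mean g \<longlongrightarrow> g 0) (at_right 0)"
proof -
  have "(duhamel_mean g \<longlongrightarrow> duhamel_mean g 0) (at 0 within {0..})"
    using continuous_on_duhamel_mean[OF g] by (auto simp: continuous_on_def)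
  then have "(duhamel_mean g \<longlongrightarrow> duhamel_mean g 0) (at_right 0)"
    by (rule tendsto_within_subset) auto
  then show ?thesis by (simp add: duhamel_mean_def T_zero)
qed

lemma duhamel_bound:
  assumes M: "\<And>s x. s \<in> {0..t} \<Longrightarrow> norm (T s x) \<le> M * norm x"
    and g: "continuous_on {0..t} g" and k: "k integrable_on {0..t}"
    and le: "\<And>s. s \<in> {0..t} \<Longrightarrow> M * norm (g s) \<le> k s"
  shows "norm (duhamel g t) \<le> integral {0..t} k"
  unfolding duhamel_def
proof (rule integral_norm_bound_integral[OF duhamel_integrable[OF g] k])
  fix s assume s: "s \<in> {0..t}"
  show "norm (T (t - s) (g s)) \<le> k s"
    using M[of "t - s" "g s"] le[OF s] s by auto
qed

lemma duhamel_diff: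
  assumes "0 \<le> t" "continuous_on {0..t} g" "continuous_on {0..t} h"
  shows "duhamel (\<lambda>s. g s - h s) t = duhamel g t - duhamel h t"
  unfolding duhamel_def
  by (subst integral_diff[symmetric])
    (auto intro!: duhamel_integrable integral_cong assms simp: linear_diff[OF bounded_linear.linear[OF lin]])

lemma duhamel_add:
  assumes "0 \<le> t" "continuous_on {0..t} g" "continuous_on {0..t} h"
  shows "duhamel (\<lambda>s. g s + h s) t = duhamel g t + duhamel h t"
  unfolding duhamel_def
  by (subst integral_add[symmetric])
    (auto intro!: duhamel_integrable integral_cong assms simp: linear_add[OF bounded_linear.linear[OF lin]])

lemma duhamel_commute:
  assumes L: "bounded_linear L" and comm: "\<And>s x. 0 \<le> s \<Longrightarrow> L (T s x) = T s (L x)"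
    and g: "continuous_on {0..t} g"
  shows "duhamel (\<lambda>s. L (g s)) t = L (duhamel g t)"
proof -
  have "integral {0..t} (L \<circ> (\<lambda>s. T (t - s) (g s))) = L (duhamel g t)"
    unfolding duhamel_def by (rule integral_linear[OF duhamel_integrable[OF g] L])
  moreover have "integral {0..t} (L \<circ> (\<lambda>s. T (t - s) (g s))) = duhamel (\<lambda>s. L (g s)) t"
    unfolding duhamel_def by (intro integral_cong) (simp add: comm)
  ultimately show ?thesis by simp
qed

text \<open>The part of the integral over \<open>{0..s}\<close> is transported by \<open>T t\<close>, the rest is a Duhamel
  integral with shifted source.\<close>

lemma duhamel_plus:
  assumes s: "0 \<le> s" and t: "0 \<le> t" and g: "continuous_on {0..t + s} g"
  shows "duhamel g (t + s) = T t (duhamel g s) + duhamel (\<lambda>\<tau>. g (\<tau> + s)) t"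
proof -
  let ?k = "\<lambda>\<tau>. T (t + s - \<tau>) (g \<tau>)"
  have gs: "continuous_on {0..s} g" by (rule continuous_on_subset[OF g]) (use t in auto)
  have "duhamel g (t + s) = integral {0..s} ?k + integral {s..t + s} ?k"
    unfolding duhamel_def
    by (rule Henstock_Kurzweil_Integration.integral_combine[symmetric, OF _ _ duhamel_integrable[OF g]]) (use s t in auto)
  also have "integral {0..s} ?k = integral {0..s} (T t \<circ> (\<lambda>\<tau>. T (s - \<tau>) (g \<tau>)))"
    using t by (intro integral_cong) (auto simp flip: T_plus simp: algebra_simps)
  also have "\<dots> = T t (duhamel g s)"
    unfolding duhamel_def by (rule integral_linear[OF duhamel_integrable[OF gs] lin[OF t]])
  also have "integral {s..t + s} ?k = duhamel (\<lambda>\<tau>. g (\<tau> + s)) t"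
    using integral_shift_real_ivl[of s s "t + s" ?k] by (simp add: duhamel_def)
  finally show ?thesis .
qed

text \<open>Uniqueness, the bound for the perturbed semigroup and both estimates of the flow are instances:
  \<open>g\<close> is the source of an equation for \<open>w\<close>, bounded by \<open>w\<close> up to an error \<open>e\<close>,
  and \<open>c\<close> bounds the contribution of the initial value.\<close>

lemma duhamel_gronwall:
  assumes M: "1 \<le> M" "\<And>t x. t \<in> {0..a} \<Longrightarrow> norm (T t x) \<le> M * norm x"
    and L: "0 \<le> L" and \<tau>: "\<tau> \<le> a"
    and w: "continuous_on {0..\<tau>} w" and g: "continuous_on {0..\<tau>} g"
    and gw: "\<And>s. s \<in> {0..\<tau>} \<Longrightarrow> norm (g s) \<le> L * norm (w s) + e" and e: "0 \<le> e"
    and rem: "\<And>t. t \<in> {0..\<tau>} \<Longrightarrow> norm (w t - duhamel g t) \<le> c"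
    and t: "t \<in> {0..\<tau>}"
  shows "norm (w t) \<le> (c + M * e * a) * exp (M * L * a)"
proof -
  have M0: "0 \<le> M" using M(1) by simp
  have c0: "0 \<le> c" using rem[OF t] norm_ge_zero order_trans by blast
  have a0: "0 \<le> a" using t \<tau> by auto
  have le: "norm (w s) \<le> (c + M * e * a) + M * L * integral {0..s} (\<lambda>\<sigma>. norm (w \<sigma>))"
    if s: "s \<in> {0..\<tau>}" for s
  proof -
    have ws: "continuous_on {0..s} w" and gs: "continuous_on {0..s} g"
      using continuous_on_subset[OF w] continuous_on_subset[OF g] s by auto
    have wi: "(\<lambda>\<sigma>. norm (w \<sigma>)) integrable_on {0..s}"
      by (intro integrable_continuous_real continuous_intros ws)
    have i: "((\<lambda>\<sigma>. M * L * norm (w \<sigma>) + M * e) has_integral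
        (M * L * integral {0..s} (\<lambda>\<sigma>. norm (w \<sigma>)) + s * (M * e))) {0..s}"
      using has_integral_add[OF has_integral_mult_right[OF integrable_integral[OF wi], of "M * L"]
          has_integral_const_real[of "M * e" 0 s]] s by simp
    have "norm (duhamel g s) \<le> integral {0..s} (\<lambda>\<sigma>. M * L * norm (w \<sigma>) + M * e)"
    proof (rule duhamel_bound[OF _ gs])
      show "norm (T \<sigma> x) \<le> M * norm x" if "\<sigma> \<in> {0..s}" for \<sigma> x
        using M(2) that s \<tau> by auto
      show "(\<lambda>\<sigma>. M * L * norm (w \<sigma>) + M * e) integrable_on {0..s}"
        using i by blast
      show "M * norm (g \<sigma>) \<le> M * L * norm (w \<sigma>) + M * e" if "\<sigma> \<in> {0..s}" for \<sigma>
        using mult_left_mono[OF gw M0, of \<sigma>] that s by (auto simp: algebra_simps)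
    qed
    also have "\<dots> = M * L * integral {0..s} (\<lambda>\<sigma>. norm (w \<sigma>)) + s * (M * e)"
      using i by (rule integral_unique)
    also have "s * (M * e) \<le> M * e * a"
      using mult_right_mono[of s a "M * e"] s \<tau> M0 e by (simp add: mult_ac)
    finally have "norm (duhamel g s) \<le> M * L * integral {0..s} (\<lambda>\<sigma>. norm (w \<sigma>)) + M * e * a"
      by simp
    then show ?thesis
      using rem[OF s] norm_triangle_ineq[of "w s - duhamel g s" "duhamel g s"] by simp
  qed
  have "norm (w t) \<le> (c + M * e * a) * exp (M * L * t)"
    by (rule gronwall_integral[OF _ _ le t]) (use M0 L in \<open>auto intro!: continuous_intros w\<close>)
  also have "\<dots> \<le> (c + M * e * a) * exp (M * L * a)"
    using M0 L c0 e a0 t \<tau> by (intro mult_left_mono) (auto intro!: mult_left_mono)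
  finally show ?thesis .
qed

end

text \<open>Replace \<open>y\<close> by the difference quotient of \<open>T\<close> at \<open>x\<close> with step \<open>h\<close>. Its Duhamel integral is
  computed by splitting \<open>duhamel (\<lambda>_. x) (t + h)\<close> in the two possible orders; the result is
  \<open>T t m - m\<close>, where \<open>m\<close> is the mean of the orbit of \<open>x\<close> over \<open>{0..h}\<close>. Then let \<open>h\<close>
  tend to \<open>0\<close>.\<close>

lemma (in linear_semigroup) duhamel_generator:
  assumes gen: "((\<lambda>t. (T t x - x) /\<^sub>R t) \<longlongrightarrow> y) (at_right 0)" and t: "0 \<le> t"
  shows "duhamel (\<lambda>_. y) t = T t x - x"
proof -
  interpret T: bounded_linear "T t" by (rule lin[OF t])
  obtain M where M: "1 \<le> M" "\<And>s x. s \<in> {0..t} \<Longrightarrow> norm (T s x) \<le> M * norm x"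
    using T_bound by blast
  let ?q = "\<lambda>h. (T h x - x) /\<^sub>R h"
  let ?m = "duhamel_mean (\<lambda>_. x)"
  have pos: "\<forall>\<^sub>F h in at_right 0. (0::real) < h"
    by (auto simp: eventually_at_topological intro!: exI[of _ UNIV])
  have q: "duhamel (\<lambda>_. ?q h) t = T t (?m h) - ?m h" if h: "0 < h" for h
  proof -
    have "duhamel (\<lambda>_. ?q h) t = duhamel (\<lambda>_. T h x - x) t /\<^sub>R h"
      by (rule duhamel_commute[where g="\<lambda>_. T h x - x"])
        (auto simp: bounded_linear_scaleR_right linear_scale[OF bounded_linear.linear[OF lin]])
    also have "duhamel (\<lambda>_. T h x - x) t = duhamel (\<lambda>_. T h x) t - duhamel (\<lambda>_. x) t"
      by (rule duhamel_diff[OF t]) auto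
    also have "duhamel (\<lambda>_. T h x) t = T h (duhamel (\<lambda>_. x) t)"
    proof (rule duhamel_commute[where g="\<lambda>_. x"])
      show "T h (T s u) = T s (T h u)" if "0 \<le> s" for s u
        using T_plus[of s h u] T_plus[of h s u] that h by (simp add: add.commute)
    qed (use h lin in auto)
    also have "T h (duhamel (\<lambda>_. x) t) - duhamel (\<lambda>_. x) t
        = T t (duhamel (\<lambda>_. x) h) - duhamel (\<lambda>_. x) h"
      using duhamel_plus[of h t "\<lambda>_. x"] duhamel_plus[of t h "\<lambda>_. x"] t h
      by (simp add: add.commute algebra_simps)
    also have "duhamel (\<lambda>_. x) h = h *\<^sub>R ?m h"
      by (rule duhamel_eq_mean) (use h in auto)
    finally show ?thesis
      using h by (simp add: T.scaleR flip: scaleR_diff_right)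
  qed
  have "(?m \<longlongrightarrow> x) (at_right 0)"
    by (rule duhamel_mean_tendsto) auto
  then have "((\<lambda>h. T t (?m h) - ?m h) \<longlongrightarrow> T t x - x) (at_right 0)"
    by (intro tendsto_intros T.tendsto)
  moreover have "\<forall>\<^sub>F h in at_right 0. T t (?m h) - ?m h = duhamel (\<lambda>_. ?q h) t"
    using pos by eventually_elim (simp add: q)
  ultimately have l1: "((\<lambda>h. duhamel (\<lambda>_. ?q h) t) \<longlongrightarrow> T t x - x) (at_right 0)"
    by (simp cong: tendsto_cong)
  have "((\<lambda>h. duhamel (\<lambda>_. ?q h) t - duhamel (\<lambda>_. y) t) \<longlongrightarrow> 0) (at_right 0)"
  proof (rule Lim_null_comparison)
    show "\<forall>\<^sub>F h in at_right 0. norm (duhamel (\<lambda>_. ?q h) t - duhamel (\<lambda>_. y) t)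
        \<le> M * norm (?q h - y) * t"
    proof (intro always_eventually allI)
      fix h
      have "norm (duhamel (\<lambda>_. ?q h - y) t) \<le> integral {0..t} (\<lambda>_. M * norm (?q h - y))"
        by (rule duhamel_bound[OF M(2)]) auto
      then show "norm (duhamel (\<lambda>_. ?q h) t - duhamel (\<lambda>_. y) t) \<le> M * norm (?q h - y) * t"
        using t duhamel_diff[OF t, of "\<lambda>_. ?q h" "\<lambda>_. y"] by (simp add: mult_ac)
    qed
    have "((\<lambda>h. M * norm (?q h - y) * t) \<longlongrightarrow> M * norm (y - y) * t) (at_right 0)"
      by (intro tendsto_intros gen)
    then show "((\<lambda>h. M * norm (?q h - y) * t) \<longlongrightarrow> 0) (at_right 0)" by simp
  qed
  then have "((\<lambda>h. duhamel (\<lambda>_. ?q h) t) \<longlongrightarrow> duhamel (\<lambda>_. y) t) (at_right 0)"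
    by (rule LIM_zero_cancel)
  then show ?thesis
    by (rule tendsto_unique[OF trivial_limit_at_right_real _ l1])
qed

section \<open>Bounded perturbation of a linear semigroup\<close>

lemma continuous_on_half_line:
  fixes f :: "real \<Rightarrow> 'a::topological_space"
  assumes "\<And>b. continuous_on {a..b} f"
  shows "continuous_on {a..} f"
  unfolding continuous_on_eq_continuous_within
proof
  fix x assume x: "x \<in> {a..}"
  have "at x within {a..} = at x within {a..x + 1}"
    by (rule at_within_nhd[of _ "{..<x + 1}"]) auto
  moreover have "continuous (at x within {a..x + 1}) f"
    using assms[of "x + 1"] x by (simp add: continuous_on_eq_continuous_within)
  ultimately show "continuous (at x within {a..}) f"
    by simp
qed

locale perturbed_semigroup = linear_semigroup T
  for T :: "real \<Rightarrow> 'z::banach \<Rightarrow> 'z" +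
  fixes B :: "'z \<Rightarrow> 'z"
  assumes B: "bounded_linear B"
begin

lemma continuous_on_B [continuous_intros]:
  "continuous_on X g \<Longrightarrow> continuous_on X (\<lambda>s. B (g s))"
  by (rule bounded_linear.continuous_on[OF B])

lemma B_bound:
  obtains b where "0 \<le> b" "\<And>x. norm (B x) \<le> b * norm x"
  using bounded_linear.nonneg_bounded[OF B] by (metis mult.commute)

text \<open>The difference of the two functions satisfies a homogeneous equation, so Gronwall's inequality
  forces it to vanish.\<close>

lemma duhamel_B_unique:
  assumes v: "continuous_on {0..a} v" and w: "continuous_on {0..a} w"
    and eq: "\<And>t. t \<in> {0..a} \<Longrightarrow>
      v t - duhamel (\<lambda>s. B (v s)) t = w t - duhamel (\<lambda>s. B (w s)) t"
    and t: "t \<in> {0..a}"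
  shows "v t = w t"
proof -
  obtain M where M: "1 \<le> M" "\<And>t x. t \<in> {0..a} \<Longrightarrow> norm (T t x) \<le> M * norm x"
    using T_bound by blast
  obtain b where b: "0 \<le> b" "\<And>x. norm (B x) \<le> b * norm x" using B_bound by blast
  have "norm (v t - w t) \<le> (0 + M * 0 * a) * exp (M * b * a)"
  proof (rule duhamel_gronwall[OF M b(1) order_refl,
        where w="\<lambda>s. v s - w s" and g="\<lambda>s. B (v s) - B (w s)"])
    show "norm (B (v s) - B (w s)) \<le> b * norm (v s - w s) + 0" for s
      using b(2)[of "v s - w s"] by (simp add: linear_diff[OF bounded_linear.linear[OF B]])
    show "norm (v s - w s - duhamel (\<lambda>\<sigma>. B (v \<sigma>) - B (w \<sigma>)) s) \<le> 0" if s: "s \<in> {0..a}" for s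
    proof -
      have "duhamel (\<lambda>\<sigma>. B (v \<sigma>) - B (w \<sigma>)) s = duhamel (\<lambda>\<sigma>. B (v \<sigma>)) s - duhamel (\<lambda>\<sigma>. B (w \<sigma>)) s"
        by (rule duhamel_diff)
          (use s in \<open>auto intro!: continuous_intros continuous_on_subset[OF v] continuous_on_subset[OF w]\<close>)
      then show ?thesis using eq[OF s] by (simp only:) (simp add: algebra_simps)
    qed
  qed (use t in \<open>auto intro!: continuous_intros v w\<close>)
  then show ?thesis by simp
qed

primrec dyson :: "nat \<Rightarrow> 'z \<Rightarrow> real \<Rightarrow> 'z" where
  "dyson 0 x = (\<lambda>t. T t x)"
| "dyson (Suc n) x = duhamel (\<lambda>s. B (dyson n x s))"

lemma continuous_on_dyson: "continuous_on {0..} (dyson n x)"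
  by (induction n) (auto intro!: T_continuous continuous_on_duhamel continuous_intros)

text \<open>The iterated integrals run over the simplex of ordered time tuples, whose volume
  \<open>t ^ n / fact n\<close> makes the series converge without any smallness assumption.\<close>

lemma norm_dyson_le:
  assumes M: "1 \<le> M" "\<And>t x. t \<in> {0..a} \<Longrightarrow> norm (T t x) \<le> M * norm x"
    and b: "0 \<le> b" "\<And>x. norm (B x) \<le> b * norm x"
    and t: "t \<in> {0..a}"
  shows "norm (dyson n x t) \<le> M * norm x * ((M * b * t) ^ n / fact n)"
  using t
proof (induction n arbitrary: t)
  case 0
  then show ?case using M(2) by simp
next
  case (Suc n)
  let ?k = "\<lambda>s. M * b * (M * norm x) * ((M * b) ^ n / fact n) * s ^ n"
  have "norm (duhamel (\<lambda>s. B (dyson n x s)) t) \<le> integral {0..t} ?k"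
  proof (rule duhamel_bound)
    show "continuous_on {0..t} (\<lambda>s. B (dyson n x s))"
      by (intro continuous_intros continuous_on_subset[OF continuous_on_dyson]) auto
    show "?k integrable_on {0..t}"
      by (intro integrable_continuous_real continuous_intros)
    fix s assume s: "s \<in> {0..t}"
    show "norm (T s y) \<le> M * norm y" for y
      using M(2) s Suc.prems by auto
    have "M * norm (B (dyson n x s)) \<le> M * (b * norm (dyson n x s))"
      using b(2) M(1) by (intro mult_left_mono) auto
    also have "\<dots> \<le> M * (b * (M * norm x * ((M * b * s) ^ n / fact n)))"
      using Suc.IH[of s] M(1) b(1) s Suc.prems by (intro mult_left_mono) auto
    also have "\<dots> = ?k s" by (simp add: power_mult_distrib)
    finally show "M * norm (B (dyson n x s)) \<le> ?k s" .
  qed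
  also have "\<dots> = M * b * (M * norm x) * ((M * b) ^ n / fact n) * (t ^ Suc n / real (Suc n))"
  proof (intro integral_unique has_integral_mult_right)
    have "((\<lambda>s. s ^ n) has_integral (t ^ Suc n / real (Suc n) - 0 ^ Suc n / real (Suc n))) {0..t}"
      using Suc.prems
      by (intro fundamental_theorem_of_calculus)
        (auto simp del: of_nat_Suc power_Suc intro!: derivative_eq_intros
          simp flip: has_real_derivative_iff_has_vector_derivative)
    then show "((\<lambda>s. s ^ n) has_integral (t ^ Suc n / real (Suc n))) {0..t}" by simp
  qed
  also have "\<dots> = M * norm x * ((M * b * t) ^ Suc n / fact (Suc n))"
    by (simp only: power_mult_distrib fact_Suc power_Suc of_nat_mult times_divide_times_eq
        times_divide_eq_right times_divide_eq_left mult_ac divide_divide_eq_left)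
  finally show ?case by simp
qed

definition perturbation :: "real \<Rightarrow> 'z \<Rightarrow> 'z" where
  "perturbation t x = (\<Sum>n. dyson n x t)"

lemma uniform_limit_dyson:
  "uniform_limit {0..a} (\<lambda>n t. \<Sum>i<n. dyson i x t) (\<lambda>t. perturbation t x) sequentially"
proof -
  obtain M where M: "1 \<le> M" "\<And>t x. t \<in> {0..a} \<Longrightarrow> norm (T t x) \<le> M * norm x"
    using T_bound by blast
  obtain b where b: "0 \<le> b" "\<And>x. norm (B x) \<le> b * norm x" using B_bound by blast
  have le: "norm (dyson n x t) \<le> M * norm x * (inverse (fact n) * (M * b * a) ^ n)"
    if t: "t \<in> {0..a}" for n t
  proof -
    have "norm (dyson n x t) \<le> M * norm x * ((M * b * t) ^ n / fact n)"
      by (rule norm_dyson_le[OF M b t])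
    also have "\<dots> \<le> M * norm x * ((M * b * a) ^ n / fact n)"
      using t M(1) b(1) by (intro mult_left_mono divide_right_mono power_mono) auto
    finally show ?thesis by (simp add: field_simps)
  qed
  have "summable (\<lambda>n. M * norm x * (inverse (fact n) * (M * b * a) ^ n))"
    by (intro summable_mult summable_exp)
  with le show ?thesis
    unfolding perturbation_def by (rule Weierstrass_m_test)
qed

lemma continuous_on_perturbation: "continuous_on {0..} (\<lambda>t. perturbation t x)"
proof (rule continuous_on_half_line)
  show "continuous_on {0..a} (\<lambda>t. perturbation t x)" for a
    by (rule uniform_limit_theorem[OF _ uniform_limit_dyson])
      (auto intro!: always_eventually continuous_on_sum continuous_on_subset[OF continuous_on_dyson])
qed

lemma dyson_partial_sum:
  assumes "0 \<le> t"
  shows "(\<Sum>i<Suc n. dyson i x t) = T t x + duhamel (\<lambda>s. B (\<Sum>i<n. dyson i x s)) t"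
proof (induction n)
  case 0
  interpret B: bounded_linear B by (rule B)
  have "duhamel (\<lambda>s. 0) t = 0"
    unfolding duhamel_def
    by (rule integral_unique, rule has_integral_eq[OF _ has_integral_0])
      (simp add: linear_0[OF bounded_linear.linear[OF lin]])
  then show ?case by (simp add: B.zero)
next
  case (Suc n)
  interpret B: bounded_linear B by (rule B)
  have c: "continuous_on {0..t} (dyson i x)" for i
    by (rule continuous_on_subset[OF continuous_on_dyson]) auto
  have "duhamel (\<lambda>s. B (\<Sum>i<n. dyson i x s) + B (dyson n x s)) t =
      duhamel (\<lambda>s. B (\<Sum>i<n. dyson i x s)) t + duhamel (\<lambda>s. B (dyson n x s)) t"
    by (rule duhamel_add[OF assms]) (intro continuous_intros c)+
  then show ?case using Suc by (simp add: B.add)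
qed

text \<open>Take the limit in the recursion for the partial sums; the Duhamel integral is continuous for
  uniform convergence on \<open>{0..t}\<close>.\<close>

lemma perturbation_eq:
  assumes t: "0 \<le> t"
  shows "perturbation t x = T t x + duhamel (\<lambda>s. B (perturbation s x)) t"
proof -
  interpret B: bounded_linear B by (rule B)
  obtain M where M: "1 \<le> M" "\<And>s x. s \<in> {0..t} \<Longrightarrow> norm (T s x) \<le> M * norm x"
    using T_bound by blast
  obtain b where b: "0 \<le> b" "\<And>x. norm (B x) \<le> b * norm x" using B_bound by blast
  let ?P = "\<lambda>n s. \<Sum>i<n. dyson i x s"
  have cP: "continuous_on {0..t} (?P n)" for n
    by (intro continuous_intros continuous_on_subset[OF continuous_on_dyson]) auto
  have cV: "continuous_on {0..t} (\<lambda>s. perturbation s x)"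
    by (rule continuous_on_subset[OF continuous_on_perturbation]) auto
  have "(\<lambda>n. duhamel (\<lambda>s. B (?P n s)) t) \<longlonglongrightarrow> duhamel (\<lambda>s. B (perturbation s x)) t"
  proof (rule LIMSEQ_I)
    fix r :: real assume r: "0 < r"
    define e where "e = r / (M * b * t + 1)"
    have Mbt: "0 \<le> M * b * t" using M(1) b(1) t by simp
    have e: "0 < e" using r Mbt by (simp add: e_def)
    have "\<forall>\<^sub>F n in sequentially. \<forall>s\<in>{0..t}. dist (?P n s) (perturbation s x) < e"
      using uniform_limit_dyson[where a=t and x=x] e by (simp add: uniform_limit_iff)
    then obtain N where N: "\<And>n s. n \<ge> N \<Longrightarrow> s \<in> {0..t} \<Longrightarrow> dist (?P n s) (perturbation s x) < e"
      unfolding eventually_sequentially by blast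
    have "norm (duhamel (\<lambda>s. B (?P n s)) t - duhamel (\<lambda>s. B (perturbation s x)) t) < r"
      if n: "n \<ge> N" for n
    proof -
      have "norm (duhamel (\<lambda>s. B (?P n s) - B (perturbation s x)) t) \<le> integral {0..t} (\<lambda>s. M * (b * e))"
      proof (rule duhamel_bound[OF M(2)])
        show "continuous_on {0..t} (\<lambda>s. B (?P n s) - B (perturbation s x))"
          by (intro continuous_intros cP cV)
        fix s assume s: "s \<in> {0..t}"
        have "norm (B (?P n s - perturbation s x)) \<le> b * e"
          using order_trans[OF b(2) mult_left_mono[OF less_imp_le b(1)]] N[OF n s]
          unfolding dist_norm by blast
        then show "M * norm (B (?P n s) - B (perturbation s x)) \<le> M * (b * e)"
          using M(1) by (intro mult_left_mono) (auto simp: B.diff)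
      qed auto
      also have "\<dots> = M * b * t * e" using t by simp
      also have "\<dots> < (M * b * t + 1) * e" using e by simp
      also have "\<dots> = r" using Mbt by (simp add: e_def)
      finally show ?thesis
        using duhamel_diff[OF t continuous_on_B[OF cP] continuous_on_B[OF cV], of n] by simp
    qed
    then show "\<exists>no. \<forall>n\<ge>no. norm (duhamel (\<lambda>s. B (?P n s)) t
        - duhamel (\<lambda>s. B (perturbation s x)) t) < r" by blast
  qed
  then have "(\<lambda>n. ?P (Suc n) t) \<longlonglongrightarrow> T t x + duhamel (\<lambda>s. B (perturbation s x)) t"
    unfolding dyson_partial_sum[OF t] by (intro tendsto_intros)
  moreover have "(\<lambda>n. ?P (Suc n) t) \<longlonglongrightarrow> perturbation t x"
    by (rule LIMSEQ_Suc, rule tendsto_uniform_limitI[OF uniform_limit_dyson[where a=t and x=x]]) (use t in auto)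
  ultimately show ?thesis by (rule LIMSEQ_unique[rotated])
qed

lemma perturbation_eqI:
  assumes w: "continuous_on {0..t} w" and t: "0 \<le> t"
    and eq: "\<And>s. s \<in> {0..t} \<Longrightarrow> w s = T s x + duhamel (\<lambda>\<sigma>. B (w \<sigma>)) s"
  shows "w t = perturbation t x"
proof (rule duhamel_B_unique[OF w])
  show "continuous_on {0..t} (\<lambda>s. perturbation s x)"
    by (rule continuous_on_subset[OF continuous_on_perturbation]) auto
  fix s assume s: "s \<in> {0..t}"
  have "perturbation s x = T s x + duhamel (\<lambda>\<sigma>. B (perturbation \<sigma> x)) s"
    by (rule perturbation_eq) (use s in auto)
  with eq[OF s] show "w s - duhamel (\<lambda>\<sigma>. B (w \<sigma>)) s
      = perturbation s x - duhamel (\<lambda>\<sigma>. B (perturbation \<sigma> x)) s"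
    by simp
qed (use t in auto)

lemma perturbation_zero: "perturbation 0 x = x"
  using perturbation_eq[of 0 x] by (simp add: duhamel_def T_zero)

text \<open>By the splitting of the Duhamel integral, the shifted orbit satisfies the equation with the
  initial value \<open>perturbation s x\<close>, so uniqueness applies.\<close>

lemma perturbation_plus:
  assumes s: "0 \<le> s" and t: "0 \<le> t"
  shows "perturbation (t + s) x = perturbation t (perturbation s x)"
proof (rule perturbation_eqI[OF _ t])
  show "continuous_on {0..t} (\<lambda>t. perturbation (t + s) x)"
    by (rule continuous_on_compose2[OF continuous_on_perturbation])
      (use s in \<open>auto intro!: continuous_intros\<close>)
  fix \<tau> assume \<tau>: "\<tau> \<in> {0..t}"
  have "perturbation (\<tau> + s) x
      = T (\<tau> + s) x + duhamel (\<lambda>\<sigma>. B (perturbation \<sigma> x)) (\<tau> + s)"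
    by (rule perturbation_eq) (use \<tau> s in auto)
  also have "\<dots> = T \<tau> (T s x) + (T \<tau> (duhamel (\<lambda>\<sigma>. B (perturbation \<sigma> x)) s)
      + duhamel (\<lambda>\<sigma>. B (perturbation (\<sigma> + s) x)) \<tau>)"
    using \<tau> s
    by (subst duhamel_plus)
      (auto simp: T_plus intro!: continuous_intros continuous_on_subset[OF continuous_on_perturbation])
  also have "\<dots> = T \<tau> (T s x + duhamel (\<lambda>\<sigma>. B (perturbation \<sigma> x)) s)
      + duhamel (\<lambda>\<sigma>. B (perturbation (\<sigma> + s) x)) \<tau>"
    using \<tau> by (simp add: linear_add[OF bounded_linear.linear[OF lin]])
  also have "T s x + duhamel (\<lambda>\<sigma>. B (perturbation \<sigma> x)) s = perturbation s x"
    using perturbation_eq[OF s] by simp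
  finally show "perturbation (\<tau> + s) x = T \<tau> (perturbation s x)
      + duhamel (\<lambda>\<sigma>. B (perturbation (\<sigma> + s) x)) \<tau>" .
qed

lemma C0_semigroup_perturbation: "C0_semigroup perturbation"
  unfolding C0_semigroup_def
  using perturbation_zero perturbation_plus continuous_on_perturbation by blast

text \<open>Applying \<open>L\<close> to the equation for \<open>x\<close> gives the equation for \<open>L x\<close>. This serves for real
  scalars and for the scalars in \<open>K\<close>.\<close>

lemma perturbation_commute:
  assumes L: "bounded_linear L" and LT: "\<And>s x. 0 \<le> s \<Longrightarrow> L (T s x) = T s (L x)"
    and LB: "\<And>x. L (B x) = B (L x)" and t: "0 \<le> t"
  shows "L (perturbation t x) = perturbation t (L x)"
proof (rule perturbation_eqI[OF _ t])
  show "continuous_on {0..t} (\<lambda>t. L (perturbation t x))"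
    by (intro bounded_linear.continuous_on[OF L] continuous_on_subset[OF continuous_on_perturbation]) auto
  fix s assume s: "s \<in> {0..t}"
  have "duhamel (\<lambda>\<sigma>. L (B (perturbation \<sigma> x))) s = L (duhamel (\<lambda>\<sigma>. B (perturbation \<sigma> x)) s)"
    by (rule duhamel_commute[OF L LT])
      (auto intro!: continuous_intros continuous_on_subset[OF continuous_on_perturbation])
  moreover have "L (perturbation s x) = L (T s x) + L (duhamel (\<lambda>\<sigma>. B (perturbation \<sigma> x)) s)"
    using perturbation_eq[of s x] s by (simp add: linear_add[OF bounded_linear.linear[OF L]])
  ultimately show "L (perturbation s x) = T s (L x) + duhamel (\<lambda>\<sigma>. B (L (perturbation \<sigma> x))) s"
    using LT s by (simp add: LB)
qed

lemma perturbation_add: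
  assumes t: "0 \<le> t"
  shows "perturbation t (x + y) = perturbation t x + perturbation t y"
proof (rule perturbation_eqI[symmetric, OF _ t])
  interpret B: bounded_linear B by (rule B)
  show "continuous_on {0..t} (\<lambda>t. perturbation t x + perturbation t y)"
    by (intro continuous_intros continuous_on_subset[OF continuous_on_perturbation]) auto
  fix s assume s: "s \<in> {0..t}"
  have "duhamel (\<lambda>\<sigma>. B (perturbation \<sigma> x) + B (perturbation \<sigma> y)) s
      = duhamel (\<lambda>\<sigma>. B (perturbation \<sigma> x)) s + duhamel (\<lambda>\<sigma>. B (perturbation \<sigma> y)) s"
    by (rule duhamel_add)
      (use s in \<open>auto intro!: continuous_intros continuous_on_subset[OF continuous_on_perturbation]\<close>)
  then show "perturbation s x + perturbation s y
      = T s (x + y) + duhamel (\<lambda>\<sigma>. B (perturbation \<sigma> x + perturbation \<sigma> y)) s"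
    using perturbation_eq[of s x] perturbation_eq[of s y] s
    by (simp add: B.add linear_add[OF bounded_linear.linear[OF lin]])
qed

lemma bounded_linear_perturbation:
  assumes t: "0 \<le> t"
  shows "bounded_linear (perturbation t)"
proof -
  obtain M where M: "1 \<le> M" "\<And>s x. s \<in> {0..t} \<Longrightarrow> norm (T s x) \<le> M * norm x"
    using T_bound by blast
  obtain b where b: "0 \<le> b" "\<And>x. norm (B x) \<le> b * norm x" using B_bound by blast
  have bd: "norm (perturbation t x) \<le> (M * norm x + M * 0 * t) * exp (M * b * t)" for x
  proof (rule duhamel_gronwall[OF M b(1) order_refl,
        where w="\<lambda>s. perturbation s x" and g="\<lambda>s. B (perturbation s x)"])
    show "norm (perturbation s x - duhamel (\<lambda>\<sigma>. B (perturbation \<sigma> x)) s) \<le> M * norm x"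
      if "s \<in> {0..t}" for s
      using perturbation_eq[of s x] M(2)[OF that, of x] that by simp
  qed (use t b in \<open>auto intro!: continuous_intros continuous_on_subset[OF continuous_on_perturbation]\<close>)
  show ?thesis
  proof (rule bounded_linear_intro)
    show "perturbation t (c *\<^sub>R x) = c *\<^sub>R perturbation t x" for c x
      using perturbation_commute[of "\<lambda>x. c *\<^sub>R x" t x] t
      by (simp add: bounded_linear_scaleR_right linear_scale[OF bounded_linear.linear[OF lin]]
          linear_scale[OF bounded_linear.linear[OF B]])
    show "norm (perturbation t x) \<le> norm x * (M * exp (M * b * t))" for x
      using bd[of x] by (simp add: mult_ac)
  qed (rule perturbation_add[OF t])
qed

lemma perturbation_difference_quotient:
  assumes t: "0 < t"
  shows "(perturbation t x - x) /\<^sub>R t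
    = (T t x - x) /\<^sub>R t + duhamel_mean (\<lambda>s. B (perturbation s x)) t"
proof -
  have "duhamel (\<lambda>s. B (perturbation s x)) t = t *\<^sub>R duhamel_mean (\<lambda>s. B (perturbation s x)) t"
    by (rule duhamel_eq_mean)
      (use t in \<open>auto intro!: continuous_intros continuous_on_subset[OF continuous_on_perturbation]\<close>)
  then show ?thesis
    using perturbation_eq[of t x] t by (simp add: algebra_simps)
qed

text \<open>The two difference quotients differ by a mean over \<open>{0..t}\<close> of the source
  \<open>B (perturbation s x)\<close>, transported by \<open>T\<close>, which converges to \<open>B x\<close>.\<close>

lemma perturbation_generator_iff:
  "((\<lambda>t. (perturbation t x - x) /\<^sub>R t) \<longlongrightarrow> y + B x) (at_right 0)
    \<longleftrightarrow> ((\<lambda>t. (T t x - x) /\<^sub>R t) \<longlongrightarrow> y) (at_right 0)"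
proof -
  let ?D = "duhamel_mean (\<lambda>s. B (perturbation s x))"
  have D: "(?D \<longlongrightarrow> B x) (at_right 0)"
    using duhamel_mean_tendsto[of "\<lambda>s. B (perturbation s x)"]
    by (simp add: continuous_intros continuous_on_perturbation perturbation_zero)
  have pos: "\<forall>\<^sub>F t in at_right 0. (0::real) < t"
    by (auto simp: eventually_at_topological intro!: exI[of _ UNIV])
  have e1: "\<forall>\<^sub>F t in at_right 0. (perturbation t x - x) /\<^sub>R t = (T t x - x) /\<^sub>R t + ?D t"
    using pos by eventually_elim (rule perturbation_difference_quotient)
  have e2: "\<forall>\<^sub>F t in at_right 0. (T t x - x) /\<^sub>R t = (perturbation t x - x) /\<^sub>R t - ?D t"
    using e1 by eventually_elim simp
  show ?thesis
  proof
    assume "((\<lambda>t. (perturbation t x - x) /\<^sub>R t) \<longlongrightarrow> y + B x) (at_right 0)"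
    from tendsto_diff[OF this D] show "((\<lambda>t. (T t x - x) /\<^sub>R t) \<longlongrightarrow> y) (at_right 0)"
      unfolding tendsto_cong[OF e2] by simp
  next
    assume "((\<lambda>t. (T t x - x) /\<^sub>R t) \<longlongrightarrow> y) (at_right 0)"
    from tendsto_add[OF this D] show "((\<lambda>t. (perturbation t x - x) /\<^sub>R t) \<longlongrightarrow> y + B x) (at_right 0)"
      unfolding tendsto_cong[OF e1] .
  qed
qed

end

section \<open>Linearity over the scalar field\<close>

lemma (in hilbert_space) norm_sc:
  assumes "c \<in> K"
  shows "norm (sc c x) = cmod c * norm x"
proof -
  have "ip (sc c x) (sc c x) = c * cnj (ip (sc c x) x)"
    by (metis assms ip_sc_left ip_commute)
  also have "\<dots> = c * cnj c * cnj (ip x x)"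
    using assms by (simp add: ip_sc_left)
  also have "cnj (ip x x) = ip x x" by (metis ip_commute)
  also have "c * cnj c = complex_of_real ((cmod c)\<^sup>2)" by (rule complex_norm_square[symmetric])
  finally have "Re (ip (sc c x) (sc c x)) = (cmod c)\<^sup>2 * Re (ip x x)" by simp
  then show ?thesis
    by (simp add: norm_eq_sqrt_ip real_sqrt_mult)
qed

lemma (in hilbert_space) bounded_linear_sc:
  assumes c: "c \<in> K"
  shows "bounded_linear (sc c)"
proof (rule bounded_linear_intro)
  show "sc c (x + y) = sc c x + sc c y" for x y by (rule sc_add_right[OF c])
  show "sc c (a *\<^sub>R x) = a *\<^sub>R sc c x" for a x
  proof -
    have a: "complex_of_real a \<in> K" using scalars by auto
    have "sc c (sc (complex_of_real a) x) = sc (complex_of_real a) (sc c x)"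
      using sc_mult[OF c a, of x] sc_mult[OF a c, of x] by (simp add: mult.commute)
    then show ?thesis by (simp add: sc_of_real)
  qed
  show "norm (sc c x) \<le> norm x * cmod c" for x using norm_sc[OF c, of x] by simp
qed

lemma (in hilbert_space) bounded_operatorI:
  assumes "bounded_linear L" "\<And>c x. c \<in> K \<Longrightarrow> L (sc c x) = sc c (L x)"
  shows "bounded_operator K sc L"
  using assms by (auto simp: bounded_operator_def linear_operator_def
      linear_add[OF bounded_linear.linear])

lemma bounded_operatorD:
  assumes "bounded_operator K sc L"
  shows "bounded_linear L" "\<And>c x. c \<in> K \<Longrightarrow> L (sc c x) = sc c (L x)"
  using assms by (auto simp: bounded_operator_def linear_operator_def)

section \<open>Generators and mild solutions\<close>

lemma C0_semigroupD:
  assumes "C0_semigroup S"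
  shows "S 0 x = x" "continuous_on {0..} (\<lambda>t. S t x)"
  using assms by (simp_all add: C0_semigroup_def)

lemma generates_C0_semigroupD:
  assumes "generates_C0_semigroup K sc D A T"
  shows "C0_semigroup T" "0 \<le> t \<Longrightarrow> bounded_operator K sc (T t)"
    "x \<in> D \<Longrightarrow> ((\<lambda>t. (T t x - x) /\<^sub>R t) \<longlongrightarrow> A x) (at_right 0)"
  using assms unfolding generates_C0_semigroup_def linear_C0_semigroup_def by blast+

lemma equation_generatesD:
  assumes "equation_generates T dom_f f S"
  shows "C0_semigroup S" "mild_solution T dom_f f p (\<lambda>t. S t p)"
    "mild_solution T dom_f f p w \<Longrightarrow> 0 \<le> t \<Longrightarrow> w t = S t p"
  using assms unfolding equation_generates_def by blast+

lemma (in linear_semigroup) mild_solution_duhamel: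
  assumes "mild_solution T dom_f f z0 w" and t: "0 \<le> t"
    and f: "continuous_on {0..t} (\<lambda>s. f (w s))"
  shows "w t = T t z0 + duhamel (\<lambda>s. f (w s)) t"
proof -
  have "has_bochner_integral_ns (lebesgue_on {0..t}) (\<lambda>s. T (t - s) (f (w s))) (w t - T t z0)"
    using assms by (auto simp: mild_solution_def)
  then have "w t - T t z0 = duhamel (\<lambda>s. f (w s)) t"
    unfolding duhamel_def has_bochner_integral_ns_continuous_eq[OF t duhamel_continuous_integrand[OF f]] .
  then show ?thesis by (simp add: algebra_simps)
qed

lemma (in linear_semigroup) mild_solutionI:
  assumes w: "continuous_on {0..} w" and dom: "\<And>s. 0 \<le> s \<Longrightarrow> w s \<in> dom_f"
    and f: "continuous_on {0..} (\<lambda>s. f (w s))"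
    and eq: "\<And>t. 0 \<le> t \<Longrightarrow> w t = T t z0 + duhamel (\<lambda>s. f (w s)) t"
  shows "mild_solution T dom_f f z0 w"
  unfolding mild_solution_def
proof (intro conjI allI impI w)
  show "AE s in lebesgue_on {0..}. w s \<in> dom_f"
    by (rule AE_I2) (simp add: dom space_restrict_space)
  fix t :: real assume t: "0 \<le> t"
  have ft: "continuous_on {0..t} (\<lambda>s. f (w s))"
    by (rule continuous_on_subset[OF f]) auto
  show "\<exists>I. has_bochner_integral_ns (lebesgue_on {0..t}) (\<lambda>s. f (w s)) I"
    using continuous_has_bochner_integral_ns[OF t ft] by blast
  have "w t - T t z0 = integral {0..t} (\<lambda>s. T (t - s) (f (w s)))"
    using eq[OF t] by (simp add: duhamel_def)
  then show "has_bochner_integral_ns (lebesgue_on {0..t}) (\<lambda>s. T (t - s) (f (w s))) (w t - T t z0)"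
    using has_bochner_integral_ns_continuous_eq[OF t duhamel_continuous_integrand[OF ft]] by blast
qed

lemma (in perturbed_semigroup) generates_perturbation:
  assumes H: "hilbert_space K sc ip" and A: "generates_C0_semigroup K sc D A T"
    and BK: "bounded_operator K sc B"
  shows "generates_C0_semigroup K sc D (\<lambda>x. A x + B x) perturbation"
proof -
  interpret hilbert_space K sc ip by (rule H)
  have D: "D = {x. \<exists>y. ((\<lambda>t. (T t x - x) /\<^sub>R t) \<longlongrightarrow> y) (at_right 0)}"
    and Ax: "\<And>x. x \<in> D \<Longrightarrow> ((\<lambda>t. (T t x - x) /\<^sub>R t) \<longlongrightarrow> A x) (at_right 0)"
    and TK: "\<And>t. 0 \<le> t \<Longrightarrow> bounded_operator K sc (T t)"
    using A by (auto simp: generates_C0_semigroup_def linear_C0_semigroup_def)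
  have "bounded_operator K sc (perturbation t)" if t: "0 \<le> t" for t
  proof (rule bounded_operatorI[OF bounded_linear_perturbation[OF t]])
    fix c x assume c: "c \<in> K"
    show "perturbation t (sc c x) = sc c (perturbation t x)"
      by (rule perturbation_commute[symmetric, OF bounded_linear_sc[OF c] _ _ t])
        (simp_all add: bounded_operatorD(2)[OF TK _ ] bounded_operatorD(2)[OF BK] c)
  qed
  moreover have "D = {x. \<exists>y. ((\<lambda>t. (perturbation t x - x) /\<^sub>R t) \<longlongrightarrow> y) (at_right 0)}"
  proof (intro set_eqI iffI)
    fix x assume "x \<in> D"
    then show "x \<in> {x. \<exists>y. ((\<lambda>t. (perturbation t x - x) /\<^sub>R t) \<longlongrightarrow> y) (at_right 0)}"
      using perturbation_generator_iff[THEN iffD2, OF Ax] by blast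
  next
    fix x assume "x \<in> {x. \<exists>y. ((\<lambda>t. (perturbation t x - x) /\<^sub>R t) \<longlongrightarrow> y) (at_right 0)}"
    then obtain y where "((\<lambda>t. (perturbation t x - x) /\<^sub>R t) \<longlongrightarrow> (y - B x) + B x) (at_right 0)"
      by auto
    then show "x \<in> D" unfolding D perturbation_generator_iff by blast
  qed
  ultimately show ?thesis
    unfolding generates_C0_semigroup_def linear_C0_semigroup_def
    using C0_semigroup_perturbation perturbation_generator_iff Ax by simp
qed

lemma (in perturbed_semigroup) equation_generates_perturbation:
  "equation_generates T UNIV B perturbation"
  unfolding equation_generates_def
proof (intro conjI allI impI C0_semigroup_perturbation)
  show "mild_solution T UNIV B z0 (\<lambda>t. perturbation t z0)" for z0
    by (rule mild_solutionI)
      (auto intro: perturbation_eq intro!: continuous_intros continuous_on_perturbation)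
  fix z0 w and t :: real assume w: "mild_solution T UNIV B z0 w" and t: "0 \<le> t"
  have c: "continuous_on {0..s} w" for s
    using w by (auto simp: mild_solution_def intro: continuous_on_subset)
  show "w t = perturbation t z0"
    by (rule perturbation_eqI[OF c t])
      (auto intro!: mild_solution_duhamel[OF w] continuous_intros c)
qed

text \<open>The source \<open>f z\<close> compensates the drift \<open>T t z - z = duhamel (\<lambda>_. - f z) t\<close> of the linear semigroup.\<close>

lemma (in linear_semigroup) mild_solution_equilibrium:
  assumes A: "((\<lambda>t. (T t z - z) /\<^sub>R t) \<longlongrightarrow> - f z) (at_right 0)" and "z \<in> dom_f"
  shows "mild_solution T dom_f f z (\<lambda>_. z)"
proof (rule mild_solutionI)
  fix t :: real assume t: "0 \<le> t"
  have "duhamel (\<lambda>_. - (- f z)) t = - duhamel (\<lambda>_. - f z) t"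
    by (rule duhamel_commute[OF bounded_linear_minus[OF bounded_linear_ident]])
      (auto simp: linear_neg[OF bounded_linear.linear[OF lin]])
  then show "z = T t z + duhamel (\<lambda>_. f z) t"
    using duhamel_generator[OF A t] by simp
qed (use assms in auto)

section \<open>Linearization of the flow at an equilibrium\<close>

text \<open>If \<open>v\<close> exceeded \<open>\<rho>\<close>, it would take the value \<open>\<rho>\<close> at some first time, by the
  intermediate value theorem. The bound would hold up to that time, and \<open>step\<close> would contradict it.\<close>

lemma continuous_trapped:
  fixes v :: "real \<Rightarrow> real"
  assumes v: "continuous_on {0..a} v" and v0: "v 0 \<le> \<rho>"
    and step: "\<And>\<tau>. \<tau> \<in> {0..a} \<Longrightarrow> (\<And>s. s \<in> {0..\<tau>} \<Longrightarrow> v s \<le> \<rho>) \<Longrightarrow> v \<tau> < \<rho>"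
    and t: "t \<in> {0..a}"
  shows "v t \<le> \<rho>"
proof (rule ccontr)
  assume "\<not> v t \<le> \<rho>"
  then have vt: "\<rho> \<le> v t" by simp
  have hit: "\<exists>s\<ge>0. s \<le> u \<and> v s = \<rho>" if "u \<in> {0..t}" "\<rho> \<le> v u" for u
    using IVT'[of v 0 \<rho> u] v0 that t continuous_on_subset[OF v, of "{0..u}"] by auto
  have vt': "continuous_on {0..t} v"
    by (rule continuous_on_subset[OF v]) (use t in auto)
  let ?E = "{s \<in> {0..t}. v s = \<rho>}"
  have "closed ?E"
    using continuous_closed_preimage_constant[OF vt'] by simp
  then have "compact ?E"
    unfolding compact_eq_bounded_closed by (auto intro: bounded_subset[of "{0..t}"])
  moreover have "?E \<noteq> {}" using hit[of t] vt t by auto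
  ultimately obtain \<tau> where \<tau>: "\<tau> \<in> ?E" "\<And>s. s \<in> ?E \<Longrightarrow> \<tau> \<le> s"
    by (meson compact_attains_inf)
  have "v \<tau> < \<rho>"
  proof (rule step)
    show "\<tau> \<in> {0..a}" using \<tau>(1) t by auto
    show "v s \<le> \<rho>" if s: "s \<in> {0..\<tau>}" for s
    proof (rule ccontr)
      assume n: "\<not> v s \<le> \<rho>"
      then obtain s' where "0 \<le> s'" "s' \<le> s" "v s' = \<rho>"
        using hit[of s] s \<tau>(1) by auto
      moreover from this have "\<tau> \<le> s'" using \<tau> s by auto
      ultimately have "s' = s" using s by auto
      then show False using n \<open>v s' = \<rho>\<close> by simp
    qed
  qed
  then show False using \<tau>(1) by simp
qed

text \<open>The hypothesis \<open>mild\<close> is the difference of the integral equations for \<open>p\<close> and for the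
  equilibrium. It is required only for orbits inside the ball, since elsewhere \<open>F\<close> need not be
  continuous and the gauge integral need not exist.\<close>

lemma (in perturbed_semigroup) flow_has_derivative:
  fixes S :: "real \<Rightarrow> 'z \<Rightarrow> 'z"
  assumes r: "0 < r" and F: "continuous_on (cball z r) F" and DF: "(F has_derivative B) (at z)"
    and S0: "\<And>p. S 0 p = p" and S: "\<And>p. continuous_on {0..} (\<lambda>t. S t p)"
    and Sz: "\<And>t. 0 \<le> t \<Longrightarrow> S t z = z"
    and mild: "\<And>p t. 0 \<le> t \<Longrightarrow> (\<And>s. s \<in> {0..t} \<Longrightarrow> S s p \<in> cball z r) \<Longrightarrow>
      S t p - z = T t (p - z) + duhamel (\<lambda>s. F (S s p) - F z) t"
    and a: "0 \<le> a"
  shows "(S a has_derivative perturbation a) (at z)"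
proof -
  interpret B: bounded_linear B by (rule B)
  obtain M where M: "1 \<le> M" "\<And>t x. t \<in> {0..a} \<Longrightarrow> norm (T t x) \<le> M * norm x"
    using T_bound by blast
  obtain b where b: "0 \<le> b" "\<And>x. norm (B x) \<le> b * norm x" using B_bound by blast
  have approx: "\<exists>d>0. \<forall>y. norm (y - z) < d \<longrightarrow> norm (F y - F z - B (y - z)) \<le> e * norm (y - z)"
    if "e > 0" for e
    using DF that by (auto simp: has_derivative_at_alt)
  obtain d1 where d1: "d1 > 0"
    "\<And>y. norm (y - z) < d1 \<Longrightarrow> norm (F y - F z - B (y - z)) \<le> norm (y - z)"
    using approx[of 1] by auto
  \<comment> \<open>Within distance \<open>\<rho>\<close> of \<open>z\<close> the function \<open>F\<close> is continuous and its linear approximation has relative error at most 1.\<close>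
  define \<rho> where "\<rho> = min r (d1 / 2)"
  have \<rho>: "0 < \<rho>" "\<rho> \<le> r" "\<rho> < d1" using r d1 by (auto simp: \<rho>_def)
  have lip: "norm (F y - F z) \<le> (b + 1) * norm (y - z)" if "norm (y - z) \<le> \<rho>" for y
    using norm_triangle_ineq[of "F y - F z - B (y - z)" "B (y - z)"] d1(2)[of y] b(2)[of "y - z"] that \<rho>
    by (simp add: algebra_simps)
  \<comment> \<open>The factor that Gronwall's inequality gives for the Lipschitz bound \<open>b + 1\<close>.\<close>
  define C where "C = M * exp (M * (b + 1) * a)"
  have C: "1 \<le> C" unfolding C_def
    using M(1) b a mult_mono[of 1 M 1 "exp (M * (b + 1) * a)"] by simp
  have cF: "continuous_on {0..\<tau>} (\<lambda>s. F (S s p) - F z)"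
    if "\<And>s. s \<in> {0..\<tau>} \<Longrightarrow> norm (S s p - z) \<le> \<rho>" for p \<tau>
  proof -
    have "continuous_on {0..\<tau>} (\<lambda>s. F (S s p))"
    proof (rule continuous_on_compose2[OF F])
      show "continuous_on {0..\<tau>} (\<lambda>s. S s p)" by (rule continuous_on_subset[OF S]) auto
      show "(\<lambda>s. S s p) ` {0..\<tau>} \<subseteq> cball z r"
        using that \<rho> by (force simp: dist_norm norm_minus_commute)
    qed
    then show ?thesis by (intro continuous_intros)
  qed
  have mild': "S t p - z = T t (p - z) + duhamel (\<lambda>s. F (S s p) - F z) t"
    if "0 \<le> t" "\<And>s. s \<in> {0..t} \<Longrightarrow> norm (S s p - z) \<le> \<rho>" for t p
    by (rule mild[OF that(1)]) (use that(2) \<rho> in \<open>force simp: dist_norm norm_minus_commute\<close>)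
  have growth: "norm (S t p - z) \<le> C * norm (p - z)"
    if \<tau>: "\<tau> \<le> a" "t \<in> {0..\<tau>}" and near: "\<And>s. s \<in> {0..\<tau>} \<Longrightarrow> norm (S s p - z) \<le> \<rho>" for t \<tau> p
  proof -
    have "norm (S t p - z) \<le> (M * norm (p - z) + M * 0 * a) * exp (M * (b + 1) * a)"
    proof (rule duhamel_gronwall[OF M _ \<tau>(1) _ cF[OF near] _ _ _ \<tau>(2), where w="\<lambda>t. S t p - z"])
      show "continuous_on {0..\<tau>} (\<lambda>t. S t p - z)"
        by (intro continuous_intros continuous_on_subset[OF S]) auto
      show "norm (S s p - z - duhamel (\<lambda>s. F (S s p) - F z) s) \<le> M * norm (p - z)"
        if "s \<in> {0..\<tau>}" for s
        using mild'[of s p] near M(2)[of s "p - z"] that \<tau>(1) by auto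
      show "norm (F (S s p) - F z) \<le> (b + 1) * norm (S s p - z) + 0" if "s \<in> {0..\<tau>}" for s
        using lip near that by simp
    qed (use b in auto)
    then show ?thesis by (simp add: C_def mult_ac)
  qed
  have stay: "norm (S t p - z) \<le> \<rho>" if p: "C * norm (p - z) < \<rho>" and t: "t \<in> {0..a}" for t p
  proof (rule continuous_trapped[OF _ _ _ t])
    show "continuous_on {0..a} (\<lambda>t. norm (S t p - z))"
      by (intro continuous_intros continuous_on_subset[OF S]) auto
    show "norm (S 0 p - z) \<le> \<rho>"
      using p mult_right_mono[OF C, of "norm (p - z)"] by (simp add: S0)
    show "norm (S \<tau> p - z) < \<rho>"
      if "\<tau> \<in> {0..a}" "\<And>s. s \<in> {0..\<tau>} \<Longrightarrow> norm (S s p - z) \<le> \<rho>" for \<tau>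
      using growth[of \<tau> \<tau> p] that p by auto
  qed
  have "\<exists>d>0. \<forall>p. norm (p - z) < d \<longrightarrow>
      norm (S a p - S a z - perturbation a (p - z)) \<le> e * norm (p - z)" if e: "e > 0" for e
  proof -
    \<comment> \<open>An error \<open>\<eta>\<close> in the linear approximation of \<open>F\<close> costs at most \<open>\<eta> * E\<close> in that of the flow.\<close>
    define E where "E = M * C * a * exp (M * b * a)"
    have E: "0 \<le> E" using M(1) C a by (simp add: E_def)
    define \<eta> where "\<eta> = e / (E + 1)"
    have \<eta>: "0 < \<eta>" using e E by (simp add: \<eta>_def)
    have \<eta>E: "\<eta> * E \<le> e" using e E by (simp add: \<eta>_def field_simps)
    obtain d2 where d2: "d2 > 0"
      "\<And>y. norm (y - z) < d2 \<Longrightarrow> norm (F y - F z - B (y - z)) \<le> \<eta> * norm (y - z)"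
      using approx[OF \<eta>] by blast
    have "norm (S a p - S a z - perturbation a (p - z)) \<le> e * norm (p - z)"
      if p: "norm (p - z) < min \<rho> d2 / C" for p
    proof -
      have Cp: "C * norm (p - z) < \<rho>" "C * norm (p - z) < d2"
        using p C by (simp_all add: less_divide_eq mult.commute)
      have near: "norm (S s p - z) \<le> \<rho>" if "s \<in> {0..a}" for s
        using stay[OF Cp(1) that] .
      have small: "norm (S s p - z) \<le> C * norm (p - z)" if "s \<in> {0..a}" for s
        using growth[OF order_refl that near] .
      let ?V = "\<lambda>s. perturbation s (p - z)"
      let ?w = "\<lambda>s. S s p - z - ?V s"
      let ?g = "\<lambda>s. F (S s p) - F z - B (?V s)"
      have cV: "continuous_on {0..s} ?V" for s
        by (rule continuous_on_subset[OF continuous_on_perturbation]) auto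
      have "norm (?w a) \<le> (0 + M * (\<eta> * (C * norm (p - z))) * a) * exp (M * b * a)"
      proof (rule duhamel_gronwall[OF M b(1) order_refl, where w="?w" and g="?g"])
        show "continuous_on {0..a} ?w"
          by (intro continuous_intros cV continuous_on_subset[OF S]) auto
        show "continuous_on {0..a} ?g"
          by (rule continuous_on_diff[OF cF[OF near] continuous_on_B[OF cV]])
        show "norm (?g s) \<le> b * norm (?w s) + \<eta> * (C * norm (p - z))" if s: "s \<in> {0..a}" for s
        proof -
          have "norm (F (S s p) - F z - B (S s p - z)) \<le> \<eta> * norm (S s p - z)"
            using d2(2)[of "S s p"] small[OF s] Cp by auto
          also have "\<dots> \<le> \<eta> * (C * norm (p - z))"
            using small[OF s] \<eta> by (intro mult_left_mono) auto
          finally have "norm (F (S s p) - F z - B (S s p - z)) \<le> \<eta> * (C * norm (p - z))" .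
          moreover have "?g s = B (?w s) + (F (S s p) - F z - B (S s p - z))"
            by (simp add: B.diff)
          then have "norm (?g s) \<le> norm (B (?w s)) + norm (F (S s p) - F z - B (S s p - z))"
            by (simp only: norm_triangle_ineq)
          ultimately show ?thesis
            using b(2)[of "?w s"] by linarith
        qed
        show "norm (?w s - duhamel ?g s) \<le> 0" if s: "s \<in> {0..a}" for s
        proof -
          have near': "norm (S \<sigma> p - z) \<le> \<rho>" if "\<sigma> \<in> {0..s}" for \<sigma>
            using near that s by auto
          have "duhamel ?g s = duhamel (\<lambda>s. F (S s p) - F z) s - duhamel (\<lambda>s. B (?V s)) s"
            by (rule duhamel_diff[OF _ cF[OF near'] continuous_on_B[OF cV]]) (use s in auto)
          then show ?thesis
            using mild'[of s p] perturbation_eq[of s "p - z"] near' s by simp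
        qed
      qed (use \<eta> C a in auto)
      also have "\<dots> = \<eta> * E * norm (p - z)" by (simp add: E_def mult_ac)
      also have "\<dots> \<le> e * norm (p - z)" using \<eta>E by (intro mult_right_mono) auto
      finally show ?thesis by (simp add: Sz[OF a])
    qed
    moreover have "0 < min \<rho> d2 / C" using \<rho> d2 C by simp
    ultimately show ?thesis by blast
  qed
  then show ?thesis
    unfolding has_derivative_at_alt using bounded_linear_perturbation[OF a] by blast
qed


theorem mainTheorem2:
  fixes K :: "complex set"
    and sc :: "complex \<Rightarrow> 'z::banach \<Rightarrow> 'z"
    and ip :: "'z \<Rightarrow> 'z \<Rightarrow> complex"
    and dom_A dom_f :: "'z set"
    and A f :: "'z \<Rightarrow> 'z"
    and Df :: "'z \<Rightarrow> 'z \<Rightarrow>\<^sub>L 'z"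
    and T S :: "real \<Rightarrow> 'z \<Rightarrow> 'z"
    and z :: 'z
    and r K_zr :: real
  assumes "hilbert_space K sc ip"
    and "linear_operator K sc dom_A A"
    and "generates_C0_semigroup K sc dom_A A T"
    and "\<forall>p\<in>dom_f. has_frechet_derivative K sc dom_f f (blinfun_apply (Df p)) p"
    and "equation_generates T dom_f f S"
    and "z \<in> dom_A \<inter> dom_f" and "A z + f z = 0"
    and "r > 0"
    and "\<forall>p\<in>cball z r \<inter> dom_A. Re (ip (A p) p) \<le> 0"
    and "\<forall>p\<in>cball z r. has_frechet_derivative K sc dom_f f (blinfun_apply (Df p)) p"
    and "locally_lipschitz_on (cball z r) Df"
    and "bdd_above ((\<lambda>\<eta>. norm (Df \<eta>)) ` cball z r)"
    and "(SUP \<eta>\<in>cball z r. norm (Df \<eta>)) = K_zr" and "K_zr > 0"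
  shows "\<exists>T_z. generates_C0_semigroup K sc dom_A (\<lambda>\<psi>. A \<psi> + blinfun_apply (Df z) \<psi>) T_z \<and>
           equation_generates T UNIV (blinfun_apply (Df z)) T_z \<and>
           (\<exists>t_f>0. \<forall>t. 0 \<le> t \<and> t \<le> t_f \<longrightarrow>
              has_frechet_derivative K sc UNIV (S t) (T_z t) z)"
proof -
  interpret hilbert_space K sc ip by (rule assms(1))
  let ?B = "blinfun_apply (Df z)"
  have gen: "generates_C0_semigroup K sc dom_A A T" by (rule assms(3))
  interpret perturbed_semigroup T ?B
  proof (intro perturbed_semigroup.intro linear_semigroup.intro perturbed_semigroup_axioms.intro)
    show "C0_semigroup T"
      by (rule generates_C0_semigroupD(1)[OF gen])
    show "bounded_linear (T t)" if "0 \<le> t" for t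
      by (rule bounded_operatorD(1)[OF generates_C0_semigroupD(2)[OF gen that]])
    show "bounded_linear ?B" by (rule blinfun.bounded_linear_right)
  qed
  have ball: "cball z r \<subseteq> dom_f"
    and fD: "\<And>p. p \<in> cball z r \<Longrightarrow> (f has_derivative blinfun_apply (Df p)) (at p within dom_f)"
    using assms(10) by (auto simp: has_frechet_derivative_def)
  have z: "z \<in> cball z r" using assms(8) by simp
  have B: "bounded_operator K sc ?B"
    using assms(10) z by (auto simp: has_frechet_derivative_def)
  have "z \<in> interior dom_f"
    by (rule interiorI[of "ball z r"]) (use ball assms(8) in auto)
  then have Df: "(f has_derivative ?B) (at z)"
    using fD[OF z] by (simp only: at_within_interior)
  have fc: "continuous_on (cball z r) f"
    unfolding continuous_on_eq_continuous_within
    by (intro ballI continuous_within_subset[OF has_derivative_continuous[OF fD] ball])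
  note S = equation_generatesD[OF assms(5)]
  have "A z = - f z" using assms(7) by (simp only: eq_neg_iff_add_eq_0)
  then have "((\<lambda>t. (T t z - z) /\<^sub>R t) \<longlongrightarrow> - f z) (at_right 0)"
    using generates_C0_semigroupD(3)[OF gen IntD1[OF assms(6)]] by (simp only:)
  then have eqm: "mild_solution T dom_f f z (\<lambda>_. z)"
    by (rule mild_solution_equilibrium[OF _ IntD2[OF assms(6)]])
  have Sc: "continuous_on {0..} (\<lambda>t. S t p)" for p
    by (rule C0_semigroupD(2)[OF S(1)])
  have flow: "S t p - z = T t (p - z) + duhamel (\<lambda>s. f (S s p) - f z) t"
    if t: "0 \<le> t" and near: "\<And>s. s \<in> {0..t} \<Longrightarrow> S s p \<in> cball z r" for p t
  proof -
    have c: "continuous_on {0..t} (\<lambda>s. f (S s p))"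
    proof (rule continuous_on_compose2[OF fc])
      show "continuous_on {0..t} (\<lambda>s. S s p)" by (rule continuous_on_subset[OF Sc]) auto
    qed (use near in auto)
    have p: "S t p = T t p + duhamel (\<lambda>s. f (S s p)) t"
      by (rule mild_solution_duhamel[OF S(2) t c])
    have z: "z = T t z + duhamel (\<lambda>_. f z) t"
      by (rule mild_solution_duhamel[OF eqm t]) auto
    have d: "duhamel (\<lambda>s. f (S s p) - f z) t = duhamel (\<lambda>s. f (S s p)) t - duhamel (\<lambda>_. f z) t"
      by (rule duhamel_diff[OF t c]) auto
    have T: "T t (p - z) = T t p - T t z"
      by (rule linear_diff[OF bounded_linear.linear[OF lin[OF t]]])
    have "S t p - z = (T t p + duhamel (\<lambda>s. f (S s p)) t) - (T t z + duhamel (\<lambda>_. f z) t)"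
      by (rule arg_cong2[where f=minus, OF p z])
    then show ?thesis by (simp only: d T add_diff_add)
  qed
  have V: "generates_C0_semigroup K sc dom_A (\<lambda>\<psi>. A \<psi> + ?B \<psi>) perturbation"
    by (rule generates_perturbation[OF assms(1) gen B])
  have "has_frechet_derivative K sc UNIV (S t) (perturbation t) z" if t: "0 \<le> t" for t
  proof -
    have "(S t has_derivative perturbation t) (at z)"
    proof (rule flow_has_derivative[OF assms(8) fc Df _ Sc _ flow t])
      show "S 0 p = p" for p by (rule C0_semigroupD(1)[OF S(1)])
      show "S s z = z" if "0 \<le> s" for s by (rule S(3)[OF eqm that, symmetric])
    qed
    then show ?thesis
      using generates_C0_semigroupD(2)[OF V t] by (simp add: has_frechet_derivative_def)
  qed
  then have "\<exists>t_f>0. \<forall>t. 0 \<le> t \<and> t \<le> t_f \<longrightarrow>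
      has_frechet_derivative K sc UNIV (S t) (perturbation t) z"
    by (intro exI[of _ "1::real"] conjI allI impI) simp_all
  then show ?thesis
    by (intro exI[of _ perturbation] conjI V equation_generates_perturbation)
qed

end
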